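(* Let $U\subset\mathbb{R}$ be an open (connected) interval and let $h:U\to\mathbb{R}$ be a real analytic function such that $h''$ is not identically zero on $U$. For $t\in U$ let $L_t$ be the line $\{(x,y)\in\mathbb{R}^2: y=tx+h(t)\}$, and for $u\neq v$ in $U$ let $\Psi(u,v)\in\mathbb{R}^2$ be the intersection point of $L_u$ and $L_v$. Let $I,J\subset U$ be nonempty open intervals with $I\cap J=\varnothing$, and suppose that $\Psi$ is a local diffeomorphism on $I\times J$. Then the Lagrangian $2$-web defined on $\Psi(I\times J)\subset(\mathbb{R}^2,dx\wedge dy)$ by the two separated tangent families $\{L_u\}_{u\in I}$ and $\{L_v\}_{v\in J}$ does not satisfy the Samuelson condition.
   Context: Lagrangian $2$-web: on an open set $M\subset\mathbb{R}^2$ with symplectic form $\omega=dx\wedge dy$, a Lagrangian $2$-web is an ordered pair $(\mathcal F_1,\mathcal F_2)$ of smooth codimension-one foliations of $M$ (automatically Lagrangian, as leaves are curves) whose leaves are transverse to each other. Locally it is given by the level curves of two smooth functions (first integrals) $u,v$ with $du\wedge dv\neq 0$. Samuelson condition: the web on $M$ satisfies the Samuelson condition if every point of $M$ has an open neighborhood $V\subset M$, with first integrals $u,v$ of $\mathcal F_1,\mathcal F_2$ on $V$ such that $(u,v)$ is a diffeomorphism of $V$ onto an open rectangle $K\times L$, for which the following holds. For all $u_0<u_1<u_2$ in $K$ and $v_0<v_1<v_2$ in $L$, let $a_{ij}$ ($i,j\in\{1,2\}$) be the Euclidean area of the quadrilateral $\{q\in V: u_{i-1}<u(q)<u_i,\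 v_{j-1}<v(q)<v_j\}$; then $a_{11}/a_{12}=a_{21}/a_{22}$. (Thus, for four adjacent small quadrilaterals cut out by three leaves of each foliation, the ratio of areas of the two in one strip equals the corresponding ratio in the neighboring strip.) Web defined by the two families: on $\Psi(P)$, where $P\subset I\times J$ is an open set on which $\Psi$ is injective, the two foliations have as first integrals the components $u$ and $v$ of $(\Psi|_P)^{-1}$, so the leaves are (locally) pieces of the lines $L_u$, $u\in I$, and of the lines $L_v$, $v\in J$, respectively. All notions are local: the web on $\Psi(I\times J)$ satisfies the Samuelson condition if and only if, for every such $P$, the web on $\Psi(P)$ does. If $\Psi$ is injective on $I\times J$, this is just the Samuelson condition for the web on the open set $\Psi(I\times J)$. *)

theory Defs
  imports "HOL-Analysis.Analysis" "HOL-Library.Disjoint_Sets"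
begin

text \<open>
  \<open>C\<^sup>k\<close> maps on an open set, by recursion on \<open>k\<close> over directional derivatives in all directions;
  on a Euclidean space this is the usual class of maps with continuous partial derivatives up to
  order \<open>k\<close>. The derivatives are taken with the filter \<open>at x\<close>, so \<open>S\<close> must be open.
\<close>

primrec smooth_upto ::
  "nat \<Rightarrow> 'a::real_normed_vector set \<Rightarrow> ('a \<Rightarrow> 'b::real_normed_vector) \<Rightarrow> bool" where
  "smooth_upto 0 S f \<longleftrightarrow> continuous_on S f"
| "smooth_upto (Suc k) S f \<longleftrightarrow>
     (\<forall>x\<in>S. f differentiable at x) \<and>
     (\<forall>w. smooth_upto k S (\<lambda>x. frechet_derivative f (at x) w))"

definition smooth_on ::
  "'a::real_normed_vector set \<Rightarrow> ('a \<Rightarrow> 'b::real_normed_vector) \<Rightarrow> bool" where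
  "smooth_on S f \<longleftrightarrow> (\<forall>k. smooth_upto k S f)"

definition diffeomorphism_on ::
  "'a::real_normed_vector set \<Rightarrow> 'b::real_normed_vector set \<Rightarrow> ('a \<Rightarrow> 'b) \<Rightarrow> bool" where
  "diffeomorphism_on S T f \<longleftrightarrow>
     open S \<and> open T \<and> bij_betw f S T \<and> smooth_on S f \<and> smooth_on T (inv_into S f)"

definition local_diffeomorphism_on ::
  "'a::real_normed_vector set \<Rightarrow> ('a \<Rightarrow> 'b::real_normed_vector) \<Rightarrow> bool" where
  "local_diffeomorphism_on S f \<longleftrightarrow>
     (\<forall>p\<in>S. \<exists>W. p \<in> W \<and> W \<subseteq> S \<and> diffeomorphism_on W (f ` W) f)"

definition real_analytic_on :: "real set \<Rightarrow> (real \<Rightarrow> real) \<Rightarrow> bool" where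
  "real_analytic_on U h \<longleftrightarrow>
     (\<forall>t\<^sub>0\<in>U. \<exists>r>0. \<exists>a. \<forall>t\<in>U. \<bar>t - t\<^sub>0\<bar> < r \<longrightarrow> (\<lambda>n. a n * (t - t\<^sub>0) ^ n) sums h t)"

text \<open>
  A codimension-one foliation of an open set \<open>M\<close> of the plane is given by its set of leaves: a
  partition of \<open>M\<close> into path-connected sets such that around every point there is a
  chart in which the local leaves are exactly the slices \<open>fst = const\<close>.
  The local leaves in an open set \<open>W\<close> are the path components of \<open>l \<inter> W\<close> for leaves \<open>l\<close>, not the sets
  \<open>l \<inter> W\<close> themselves, since a leaf may return to \<open>W\<close> many times.
\<close>

definition foliation_on :: "(real \<times> real) set \<Rightarrow> (real \<times> real) set set \<Rightarrow> bool" where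
  "foliation_on M F \<longleftrightarrow>
     open M \<and> partition_on M F \<and> (\<forall>l\<in>F. path_connected l) \<and>
     (\<forall>p\<in>M. \<exists>W A B \<phi>. p \<in> W \<and> W \<subseteq> M \<and> is_interval A \<and> is_interval B \<and>
        diffeomorphism_on W (A \<times> B) (\<phi> :: real \<times> real \<Rightarrow> real \<times> real) \<and>
        (\<forall>l\<in>F. \<forall>q\<in>l \<inter> W.
           path_component_set (l \<inter> W) q = {r\<in>W. fst (\<phi> r) = fst (\<phi> q)}))"

definition first_integral_on ::
  "(real \<times> real) set \<Rightarrow> (real \<times> real) set set \<Rightarrow> (real \<times> real \<Rightarrow> real) \<Rightarrow> bool" where
  "first_integral_on V F u \<longleftrightarrow>
     smooth_on V u \<and>
     (\<forall>q\<in>V. frechet_derivative u (at q) \<noteq> (\<lambda>_. 0)) \<and>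
     (\<forall>l\<in>F. \<forall>q r. path_component (l \<inter> V) q r \<longrightarrow> u q = u r)"

text \<open>The coefficient of \<open>du \<and> dv\<close> with respect to \<open>dx \<and> dy\<close>.\<close>

definition wedge_coeff ::
  "(real \<times> real \<Rightarrow> real) \<Rightarrow> (real \<times> real \<Rightarrow> real) \<Rightarrow> real \<times> real \<Rightarrow> real" where
  "wedge_coeff u v q =
     frechet_derivative u (at q) (1, 0) * frechet_derivative v (at q) (0, 1) -
     frechet_derivative u (at q) (0, 1) * frechet_derivative v (at q) (1, 0)"

text \<open>
  Leaves are curves, hence automatically Lagrangian for \<open>dx \<and> dy\<close>. Transversality is expressed
  through local first integrals.
\<close>

type_synonym web = "(real \<times> real) set set \<times> (real \<times> real) set set"

definition lagrangian_web_on :: "(real \<times> real) set \<Rightarrow> web \<Rightarrow> bool" where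
  "lagrangian_web_on M \<W> \<longleftrightarrow>
     foliation_on M (fst \<W>) \<and> foliation_on M (snd \<W>) \<and>
     (\<forall>p\<in>M. \<exists>V u v. open V \<and> p \<in> V \<and> V \<subseteq> M \<and>
        first_integral_on V (fst \<W>) u \<and> first_integral_on V (snd \<W>) v \<and>
        (\<forall>q\<in>V. wedge_coeff u v q \<noteq> 0))"

definition quad_area ::
  "(real \<times> real) set \<Rightarrow> (real \<times> real \<Rightarrow> real) \<Rightarrow> (real \<times> real \<Rightarrow> real) \<Rightarrow>
     real \<Rightarrow> real \<Rightarrow> real \<Rightarrow> real \<Rightarrow> real" where
  "quad_area V u v a b c d = measure lborel {q\<in>V. a < u q \<and> u q < b \<and> c < v q \<and> v q < d}"

text \<open>
  The closed rectangle spanned by the three values of \<open>u\<close> and of \<open>v\<close> is a compact subset of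
  \<open>K \<times> L\<close>, so all areas below are finite and positive and the quotients are genuine.
\<close>

definition samuelson_condition :: "(real \<times> real) set \<Rightarrow> web \<Rightarrow> bool" where
  "samuelson_condition M \<W> \<longleftrightarrow>
     (\<forall>p\<in>M. \<exists>V K L u v. open V \<and> p \<in> V \<and> V \<subseteq> M \<and>
        first_integral_on V (fst \<W>) u \<and> first_integral_on V (snd \<W>) v \<and>
        open K \<and> is_interval K \<and> open L \<and> is_interval L \<and>
        diffeomorphism_on V (K \<times> L) (\<lambda>q. (u q, v q)) \<and>
        (\<forall>u\<^sub>0\<in>K. \<forall>u\<^sub>1\<in>K. \<forall>u\<^sub>2\<in>K. \<forall>v\<^sub>0\<in>L. \<forall>v\<^sub>1\<in>L. \<forall>v\<^sub>2\<in>L.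
           u\<^sub>0 < u\<^sub>1 \<and> u\<^sub>1 < u\<^sub>2 \<and> v\<^sub>0 < v\<^sub>1 \<and> v\<^sub>1 < v\<^sub>2 \<longrightarrow>
           quad_area V u v u\<^sub>0 u\<^sub>1 v\<^sub>0 v\<^sub>1 / quad_area V u v u\<^sub>0 u\<^sub>1 v\<^sub>1 v\<^sub>2 =
           quad_area V u v u\<^sub>1 u\<^sub>2 v\<^sub>0 v\<^sub>1 / quad_area V u v u\<^sub>1 u\<^sub>2 v\<^sub>1 v\<^sub>2))"

text \<open>The foliation of \<open>M\<close> with first integral \<open>u\<close>: its leaves are the components of the level sets.\<close>

definition level_foliation ::
  "(real \<times> real) set \<Rightarrow> (real \<times> real \<Rightarrow> real) \<Rightarrow> (real \<times> real) set set" where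
  "level_foliation M u = (\<lambda>q. path_component_set {r\<in>M. u r = u q} q) ` M"

definition line :: "(real \<Rightarrow> real) \<Rightarrow> real \<Rightarrow> (real \<times> real) set" where
  "line h t = {(x, y). y = t * x + h t}"

text \<open>Meaningful only at pairs \<open>(u, v)\<close> with \<open>u \<noteq> v\<close>; see \<open>line_meet_eq\<close>.\<close>

definition line_meet :: "(real \<Rightarrow> real) \<Rightarrow> real \<times> real \<Rightarrow> real \<times> real" where
  "line_meet h = (\<lambda>(u, v). THE q. q \<in> line h u \<inter> line h v)"

text \<open>The web on \<open>line_meet h ` P\<close>, for \<open>P\<close> an open set on which \<open>line_meet h\<close> is injective.\<close>

definition tangent_web :: "(real \<Rightarrow> real) \<Rightarrow> (real \<times> real) set \<Rightarrow> web" where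
  "tangent_web h P =
     (level_foliation (line_meet h ` P) (fst \<circ> inv_into P (line_meet h)),
      level_foliation (line_meet h ` P) (snd \<circ> inv_into P (line_meet h)))"

lemma line_meet_eq:
  assumes "u \<noteq> v"
  shows "line h u \<inter> line h v = {line_meet h (u, v)}"
    and "line_meet h (u, v) = ((h v - h u) / (u - v), u * ((h v - h u) / (u - v)) + h u)"
proof -
  let ?q = "((h v - h u) / (u - v), u * ((h v - h u) / (u - v)) + h u)"
  have "q \<in> line h u \<inter> line h v \<longleftrightarrow> q = ?q" for q
  proof (cases q)
    case (Pair x y)
    have "x = (h v - h u) / (u - v) \<longleftrightarrow> u * x + h u = v * x + h v"
      using assms by (auto simp: field_simps)
    then show ?thesis using Pair by (auto simp: line_def)
  qed
  then have eq: "line h u \<inter> line h v = {?q}" by blast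
  show meet: "line_meet h (u, v) = ?q"
    unfolding line_meet_def prod.case eq by (rule the_equality) auto
  from eq meet show "line h u \<inter> line h v = {line_meet h (u, v)}" by simp
qed


subsection \<open>The tangent web is a Lagrangian web\<close>

lemma smooth_upto_cong:
  assumes "open S" "\<And>x. x \<in> S \<Longrightarrow> f x = g x" "smooth_upto k S f"
  shows "smooth_upto k S g"
  using assms(2,3)
proof (induction k arbitrary: f g)
  case 0
  then show ?case by (simp cong: continuous_on_cong)
next
  case (Suc k)
  have d: "f differentiable at x" if "x \<in> S" for x using Suc.prems(2) that by simp
  have g: "g differentiable at x" if x: "x \<in> S" for x
  proof -
    obtain D where "(f has_derivative D) (at x)" using d[OF x] unfolding differentiable_def by blast
    then have "(g has_derivative D) (at x)"
      using assms(1) x Suc.prems(1) by (rule has_derivative_transform_within_open)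
    then show ?thesis unfolding differentiable_def by blast
  qed
  have "smooth_upto k S (\<lambda>x. frechet_derivative g (at x) w)" for w
  proof (rule Suc.IH)
    show "smooth_upto k S (\<lambda>x. frechet_derivative f (at x) w)" using Suc.prems(2) by simp
    show "frechet_derivative f (at x) w = frechet_derivative g (at x) w" if "x \<in> S" for x
      using frechet_derivative_transform_within_open[OF d[OF that] assms(1) that Suc.prems(1)] by simp
  qed
  then show ?case using g by simp
qed

lemma smooth_upto_linear:
  assumes "open S" "bounded_linear L" "smooth_upto k S f"
  shows "smooth_upto k S (\<lambda>x. L (f x))"
  using assms(3)
proof (induction k arbitrary: f)
  case 0
  then show ?case using bounded_linear.continuous_on[OF assms(2)] by simp
next
  case (Suc k)
  have hd: "((\<lambda>x. L (f x)) has_derivative (\<lambda>w. L (frechet_derivative f (at x) w))) (at x)"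
    if "x \<in> S" for x
    using Suc.prems that
    by (intro bounded_linear.has_derivative[OF assms(2)]) (simp add: frechet_derivative_works[symmetric])
  have "smooth_upto k S (\<lambda>x. frechet_derivative (\<lambda>x. L (f x)) (at x) w)" for w
  proof (rule smooth_upto_cong[OF assms(1)])
    show "smooth_upto k S (\<lambda>x. L (frechet_derivative f (at x) w))" using Suc by simp
  qed (simp add: frechet_derivative_at[OF hd, symmetric])
  then show ?case using hd unfolding smooth_upto.simps differentiable_def by blast
qed

lemma smooth_upto_precompose_linear:
  assumes "open S" "bounded_linear L" "smooth_upto k S f"
  shows "smooth_upto k (L -` S) (\<lambda>x. f (L x))"
  using assms(3)
proof (induction k arbitrary: f)
  case 0
  have "continuous_on (L -` S) L" by (simp add: assms(2) linear_continuous_on)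
  then show ?case using continuous_on_compose2[of S f "L -` S" L] 0 by auto
next
  case (Suc k)
  have op: "open (L -` S)"
    using assms(1,2) by (intro open_vimage linear_continuous_on)
  have hd: "((\<lambda>x. f (L x)) has_derivative (\<lambda>w. frechet_derivative f (at (L x)) (L w))) (at x)"
    if "x \<in> L -` S" for x
  proof -
    have "(f has_derivative frechet_derivative f (at (L x))) (at (L x))"
      using Suc.prems that by (simp add: frechet_derivative_works[symmetric])
    from has_derivative_compose[OF bounded_linear_imp_has_derivative[OF assms(2)] this]
    show ?thesis .
  qed
  have "smooth_upto k (L -` S) (\<lambda>x. frechet_derivative (\<lambda>x. f (L x)) (at x) w)" for w
  proof (rule smooth_upto_cong[OF op])
    show "smooth_upto k (L -` S) (\<lambda>x. frechet_derivative f (at (L x)) (L w))"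
      using Suc.IH[of "\<lambda>x. frechet_derivative f (at x) (L w)"] Suc.prems by simp
  qed (use frechet_derivative_at[OF hd, symmetric] in simp)
  then show ?case using hd unfolding smooth_upto.simps differentiable_def by blast
qed

lemma smooth_upto_subset: "smooth_upto k S f \<Longrightarrow> T \<subseteq> S \<Longrightarrow> smooth_upto k T f"
  by (induction k arbitrary: f) (auto intro: continuous_on_subset)

lemma smooth_upto_local:
  assumes "\<And>p. p \<in> S \<Longrightarrow> \<exists>W. open W \<and> p \<in> W \<and> smooth_upto k W f"
  shows "smooth_upto k S f"
  using assms
proof (induction k arbitrary: f)
  case 0
  have "continuous (at p) f" if "p \<in> S" for p
    using 0[OF that] by (auto simp: continuous_on_eq_continuous_at)
  then show ?case by (simp add: continuous_at_imp_continuous_on)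
next
  case (Suc k)
  have "smooth_upto k S (\<lambda>x. frechet_derivative f (at x) w)" for w
  proof (rule Suc.IH)
    fix p assume "p \<in> S"
    then show "\<exists>W. open W \<and> p \<in> W \<and> smooth_upto k W (\<lambda>x. frechet_derivative f (at x) w)"
      using Suc.prems[of p] by auto
  qed
  moreover have "f differentiable at p" if "p \<in> S" for p using Suc.prems[OF that] by auto
  ultimately show ?case by simp
qed

lemma smooth_on_cong:
  "open S \<Longrightarrow> (\<And>x. x \<in> S \<Longrightarrow> f x = g x) \<Longrightarrow> smooth_on S f \<Longrightarrow> smooth_on S g"
  unfolding smooth_on_def using smooth_upto_cong by blast

lemma smooth_on_subset: "smooth_on S f \<Longrightarrow> T \<subseteq> S \<Longrightarrow> smooth_on T f"
  unfolding smooth_on_def using smooth_upto_subset by blast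

lemma smooth_on_local:
  "(\<And>p. p \<in> S \<Longrightarrow> \<exists>W. open W \<and> p \<in> W \<and> smooth_on W f) \<Longrightarrow> smooth_on S f"
  unfolding smooth_on_def by (intro allI smooth_upto_local) blast

lemma smooth_on_linear: "open S \<Longrightarrow> bounded_linear L \<Longrightarrow> smooth_on S f \<Longrightarrow> smooth_on S (\<lambda>x. L (f x))"
  unfolding smooth_on_def using smooth_upto_linear by blast

lemma smooth_on_precompose_linear:
  "open S \<Longrightarrow> bounded_linear L \<Longrightarrow> smooth_on S f \<Longrightarrow> smooth_on (L -` S) (\<lambda>x. f (L x))"
  unfolding smooth_on_def using smooth_upto_precompose_linear by blast

lemma smooth_on_continuous: "smooth_on S f \<Longrightarrow> continuous_on S f"
  unfolding smooth_on_def by (metis smooth_upto.simps(1))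

lemma smooth_on_differentiable: "smooth_on S f \<Longrightarrow> x \<in> S \<Longrightarrow> f differentiable at x"
  unfolding smooth_on_def by (metis smooth_upto.simps(2))

lemma diffeomorphism_on_local_inverse:
  fixes f :: "'a::euclidean_space \<Rightarrow> 'a"
  assumes ld: "local_diffeomorphism_on S f" and P: "open P" "P \<subseteq> S" "inj_on f P"
  shows "diffeomorphism_on (f ` P) P (inv_into P f)"
proof -
  have sm: "smooth_on P f"
  proof (rule smooth_on_local)
    fix p assume "p \<in> P"
    then obtain W where "p \<in> W" "diffeomorphism_on W (f ` W) f"
      using ld P unfolding local_diffeomorphism_on_def by blast
    then show "\<exists>W. open W \<and> p \<in> W \<and> smooth_on W f" unfolding diffeomorphism_on_def by blast
  qed
  have op: "open (f ` Q)" if "open Q" "Q \<subseteq> P" for Q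
    using invariance_of_domain[of Q f] that P(3) smooth_on_continuous[OF sm]
    by (meson continuous_on_subset inj_on_subset)
  have "smooth_on (f ` P) (inv_into P f)"
  proof (rule smooth_on_local)
    fix y assume "y \<in> f ` P"
    then obtain p where p: "p \<in> P" "y = f p" by blast
    then obtain W where W: "p \<in> W" "diffeomorphism_on W (f ` W) f"
      using ld P unfolding local_diffeomorphism_on_def by blast
    have o: "open (f ` (W \<inter> P))" using op W P unfolding diffeomorphism_on_def by auto
    have iW: "inj_on f W" using W unfolding diffeomorphism_on_def bij_betw_def by blast
    have "smooth_on (f ` (W \<inter> P)) (inv_into W f)"
    proof (rule smooth_on_subset)
      show "smooth_on (f ` W) (inv_into W f)" using W(2) unfolding diffeomorphism_on_def by simp
    qed auto
    moreover have "inv_into W f x = inv_into P f x" if "x \<in> f ` (W \<inter> P)" for x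
      using that iW P(3) by (auto simp: inv_into_f_f)
    ultimately have "smooth_on (f ` (W \<inter> P)) (inv_into P f)" using smooth_on_cong[OF o] by blast
    then show "\<exists>W. open W \<and> y \<in> W \<and> smooth_on W (inv_into P f)" using o p W by blast
  qed
  moreover have "bij_betw (inv_into P f) (f ` P) P"
    using P(3) by (simp add: bij_betw_inv_into inj_on_imp_bij_betw)
  moreover have "smooth_on P (inv_into (f ` P) (inv_into P f))"
  proof (rule smooth_on_cong[OF P(1) _ sm])
    show "f x = inv_into (f ` P) (inv_into P f) x" if "x \<in> P" for x
      using P(3) that by (simp add: inv_into_inv_into_eq inj_on_imp_bij_betw)
  qed
  ultimately show ?thesis using P op unfolding diffeomorphism_on_def by auto
qed

lemma diffeomorphism_on_restrict:
  assumes "diffeomorphism_on M P \<phi>" "open R" "R \<subseteq> P"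
  shows "diffeomorphism_on {q\<in>M. \<phi> q \<in> R} R \<phi>"
proof -
  let ?W = "{q\<in>M. \<phi> q \<in> R}"
  have M: "open M" "bij_betw \<phi> M P" "smooth_on M \<phi>" "smooth_on P (inv_into M \<phi>)"
    using assms unfolding diffeomorphism_on_def by auto
  have "open (M \<inter> \<phi> -` R)"
    by (rule continuous_open_preimage[OF smooth_on_continuous]) (use M assms in auto)
  moreover have "M \<inter> \<phi> -` R = ?W" by auto
  ultimately have o: "open ?W" by simp
  have b: "bij_betw \<phi> ?W R"
    using M(2) assms(3) unfolding bij_betw_def inj_on_def by (auto simp: image_iff)
  have "smooth_on R (inv_into ?W \<phi>)"
  proof (rule smooth_on_cong[OF assms(2)])
    show "smooth_on R (inv_into M \<phi>)" using M(4) assms(3) by (rule smooth_on_subset)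
    show "inv_into M \<phi> x = inv_into ?W \<phi> x" if "x \<in> R" for x
    proof -
      have "x \<in> \<phi> ` ?W" using bij_betw_imp_surj_on[OF b] that by simp
      then obtain w where w: "w \<in> ?W" "x = \<phi> w" by (rule imageE) simp
      have "inv_into M \<phi> x = w"
        unfolding w(2) using w(1) by (intro inv_into_f_f bij_betw_imp_inj_on[OF M(2)]) simp
      moreover have "inv_into ?W \<phi> x = w"
        unfolding w(2) using w(1) by (intro inv_into_f_f bij_betw_imp_inj_on[OF b])
      ultimately show ?thesis by simp
    qed
  qed
  then show ?thesis
    using o b M(3) assms(2) smooth_on_subset[of M \<phi> ?W] unfolding diffeomorphism_on_def by auto
qed

lemma bounded_linear_swap: "bounded_linear (prod.swap :: real \<times> real \<Rightarrow> real \<times> real)"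
proof -
  have "(prod.swap :: real \<times> real \<Rightarrow> _) = (\<lambda>x. (snd x, fst x))" by auto
  moreover have "bounded_linear (\<lambda>x :: real \<times> real. (snd x, fst x))"
    by (intro bounded_linear_Pair bounded_linear_fst bounded_linear_snd)
  ultimately show ?thesis by simp
qed

lemma diffeomorphism_on_swap:
  fixes \<phi> :: "real \<times> real \<Rightarrow> real \<times> real"
  assumes "diffeomorphism_on M P \<phi>"
  shows "diffeomorphism_on M (prod.swap -` P) (\<lambda>q. prod.swap (\<phi> q))"
proof -
  have M: "open M" "open P" "bij_betw \<phi> M P" "smooth_on M \<phi>" "smooth_on P (inv_into M \<phi>)"
    using assms unfolding diffeomorphism_on_def by auto
  have o: "open (prod.swap -` P)"
    using M(2) bounded_linear_swap by (intro open_vimage linear_continuous_on)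
  have b: "bij_betw (\<lambda>q. prod.swap (\<phi> q)) M (prod.swap -` P)"
  proof (rule bij_betw_imageI)
    show "inj_on (\<lambda>q. prod.swap (\<phi> q)) M"
    proof (rule inj_onI)
      fix x y assume "x \<in> M" "y \<in> M" "prod.swap (\<phi> x) = prod.swap (\<phi> y)"
      moreover have "\<phi> x = \<phi> y" using calculation(3) by (metis swap_swap)
      ultimately show "x = y" using M(3) unfolding bij_betw_def inj_on_def by blast
    qed
    have P: "P = \<phi> ` M" using M(3) unfolding bij_betw_def by blast
    show "(\<lambda>q. prod.swap (\<phi> q)) ` M = prod.swap -` P"
    proof
      show "(\<lambda>q. prod.swap (\<phi> q)) ` M \<subseteq> prod.swap -` P" using P by auto
      show "prod.swap -` P \<subseteq> (\<lambda>q. prod.swap (\<phi> q)) ` M"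
      proof
        fix x assume "x \<in> prod.swap -` P"
        then obtain q where "q \<in> M" "prod.swap x = \<phi> q" unfolding P by auto
        then show "x \<in> (\<lambda>q. prod.swap (\<phi> q)) ` M" by (metis image_eqI swap_swap)
      qed
    qed
  qed
  have "smooth_on (prod.swap -` P) (inv_into M (\<lambda>q. prod.swap (\<phi> q)))"
  proof (rule smooth_on_cong[OF o])
    show "smooth_on (prod.swap -` P) (\<lambda>x. inv_into M \<phi> (prod.swap x))"
      by (rule smooth_on_precompose_linear[OF M(2) bounded_linear_swap M(5)])
    show "inv_into M \<phi> (prod.swap x) = inv_into M (\<lambda>q. prod.swap (\<phi> q)) x"
      if x: "x \<in> prod.swap -` P" for x
    proof -
      obtain w where "w \<in> M" "x = prod.swap (\<phi> w)"
        using b x unfolding bij_betw_def by blast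
      then show ?thesis
        using M(3) inv_into_f_f[of "\<lambda>q. prod.swap (\<phi> q)" M w] b
        unfolding bij_betw_def by (auto simp: inv_into_f_f)
    qed
  qed
  then show ?thesis
    using o b M smooth_on_linear[OF M(1) bounded_linear_swap M(4)] unfolding diffeomorphism_on_def by auto
qed

lemma level_foliation_leaf:
  assumes "l \<in> level_foliation M u" "q \<in> l"
  shows "q \<in> M" "l = path_component_set {r\<in>M. u r = u q} q"
proof -
  obtain p where p: "p \<in> M" "l = path_component_set {r\<in>M. u r = u p} p"
    using assms(1) unfolding level_foliation_def by blast
  have q: "q \<in> M" "u q = u p"
    using p assms(2) path_component_subset[of "{r\<in>M. u r = u p}" p] by auto
  then show "q \<in> M" by simp
  show "l = path_component_set {r\<in>M. u r = u q} q"
    using path_component_eq[of q "{r\<in>M. u r = u p}" p] p q assms(2) by simp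
qed

lemma foliation_on_level_fst:
  fixes \<phi> :: "real \<times> real \<Rightarrow> real \<times> real"
  assumes "diffeomorphism_on M P \<phi>"
  shows "foliation_on M (level_foliation M (\<lambda>q. fst (\<phi> q)))"
proof -
  let ?F = "level_foliation M (\<lambda>q. fst (\<phi> q))"
  have M: "open M" "open P" "bij_betw \<phi> M P" "smooth_on M \<phi>" "smooth_on P (inv_into M \<phi>)"
    using assms unfolding diffeomorphism_on_def by auto
  have part: "partition_on M ?F"
  proof (rule partition_onI)
    show "\<Union>?F = M"
    proof
      show "\<Union>?F \<subseteq> M" using level_foliation_leaf(1) by blast
      show "M \<subseteq> \<Union>?F"
        unfolding level_foliation_def
        by (intro subsetI UnionI, rule imageI, assumption) (simp add: path_component_refl_eq)
    qed
    show "disjnt l l'" if "l \<in> ?F" "l' \<in> ?F" "l \<noteq> l'" for l l'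
      using that level_foliation_leaf(2) unfolding disjnt_def by blast
    show "{} \<notin> ?F"
    proof
      assume "{} \<in> ?F"
      then obtain q where "q \<in> M" "path_component_set {r\<in>M. fst (\<phi> r) = fst (\<phi> q)} q = {}"
        unfolding level_foliation_def by (metis (no_types, lifting) imageE)
      then show False unfolding path_component_eq_empty by simp
    qed
  qed
  have pc: "path_connected l" if "l \<in> ?F" for l
    using that unfolding level_foliation_def by auto
  have chart: "\<exists>W A B \<phi>'. p \<in> W \<and> W \<subseteq> M \<and> is_interval A \<and> is_interval B \<and>
        diffeomorphism_on W (A \<times> B) (\<phi>' :: real \<times> real \<Rightarrow> real \<times> real) \<and>
        (\<forall>l\<in>?F. \<forall>q\<in>l \<inter> W.
           path_component_set (l \<inter> W) q = {r\<in>W. fst (\<phi>' r) = fst (\<phi>' q)})" if p: "p \<in> M" for p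
  proof -
    have "\<phi> p \<in> P" using M(3) p unfolding bij_betw_def by blast
    then obtain A' B' where AB': "open A'" "open B'" "\<phi> p \<in> A' \<times> B'" "A' \<times> B' \<subseteq> P"
      using M(2) open_prod_elim by blast
    obtain a where a: "a > 0" "ball (fst (\<phi> p)) a \<subseteq> A'" using AB' open_contains_ball
      by (metis mem_Times_iff)
    obtain b where b: "b > 0" "ball (snd (\<phi> p)) b \<subseteq> B'" using AB' open_contains_ball
      by (metis mem_Times_iff)
    define A where "A = ball (fst (\<phi> p)) a"
    define B where "B = ball (snd (\<phi> p)) b"
    define W where "W = {q\<in>M. \<phi> q \<in> A \<times> B}"
    have AB: "A \<times> B \<subseteq> P" "open (A \<times> B)" "convex A" "convex B" "\<phi> p \<in> A \<times> B"
      using a b AB' unfolding A_def B_def by (auto simp: open_Times mem_Times_iff)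
    have d: "diffeomorphism_on W (A \<times> B) \<phi>"
      unfolding W_def using diffeomorphism_on_restrict[OF assms AB(2,1)] .
    have "path_component_set (l \<inter> W) q = {r\<in>W. fst (\<phi> r) = fst (\<phi> q)}"
      if l: "l \<in> ?F" "q \<in> l \<inter> W" for l q
    proof
      let ?S = "{r\<in>W. fst (\<phi> r) = fst (\<phi> q)}"
      have leq: "l = path_component_set {r\<in>M. fst (\<phi> r) = fst (\<phi> q)} q"
        using level_foliation_leaf(2)[OF l(1)] l(2) by blast
      show "path_component_set (l \<inter> W) q \<subseteq> ?S"
        using path_component_subset[of "l \<inter> W" q]
          path_component_subset[of "{r\<in>M. fst (\<phi> r) = fst (\<phi> q)}" q] leq by blast
      have SI: "?S = inv_into W \<phi> ` ({fst (\<phi> q)} \<times> B)"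
      proof -
        have bW: "inj_on \<phi> W" "\<phi> ` W = A \<times> B"
          using d unfolding diffeomorphism_on_def bij_betw_def by auto
        have "r \<in> inv_into W \<phi> ` ({fst (\<phi> q)} \<times> B)" if "r \<in> ?S" for r
        proof (rule image_eqI)
          show "r = inv_into W \<phi> (\<phi> r)" using bW that by simp
          show "\<phi> r \<in> {fst (\<phi> q)} \<times> B" using that by (auto simp: W_def mem_Times_iff)
        qed
        moreover have "inv_into W \<phi> x \<in> ?S" if "x \<in> {fst (\<phi> q)} \<times> B" for x
        proof -
          have "fst (\<phi> q) \<in> A" using l(2) bW(2) by (auto simp: W_def mem_Times_iff)
          then have "x \<in> \<phi> ` W" using that bW(2) by auto
          then have "inv_into W \<phi> x \<in> W" "\<phi> (inv_into W \<phi> x) = x"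
            by (auto intro: inv_into_into f_inv_into_f)
          then show ?thesis using that by auto
        qed
        ultimately show ?thesis by (intro subset_antisym subsetI) blast+
      qed
      have fA: "fst (\<phi> q) \<in> A" using l(2) by (auto simp: W_def mem_Times_iff)
      have "continuous_on ({fst (\<phi> q)} \<times> B) (inv_into W \<phi>)"
      proof (rule continuous_on_subset)
        show "continuous_on (A \<times> B) (inv_into W \<phi>)"
          using d unfolding diffeomorphism_on_def by (intro smooth_on_continuous) simp
      qed (use fA in auto)
      moreover have "path_connected ({fst (\<phi> q)} \<times> B)"
        using AB(4) by (intro convex_imp_path_connected convex_Times) auto
      ultimately have pS: "path_connected ?S"
        unfolding SI by (rule path_connected_continuous_image)
      have qS: "q \<in> ?S" using l by auto
      have "?S \<subseteq> {r\<in>M. fst (\<phi> r) = fst (\<phi> q)}" unfolding W_def by auto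
      then have "?S \<subseteq> l" using path_component_maximal[OF qS pS] leq by simp
      then show "?S \<subseteq> path_component_set (l \<inter> W) q"
        using path_component_maximal[OF qS pS] by auto
    qed
    moreover have "p \<in> W" "W \<subseteq> M" using p AB unfolding W_def by auto
    moreover have "is_interval A" "is_interval B"
      using AB(3,4) by (simp_all add: is_interval_convex_1)
    ultimately show ?thesis using d
      by (intro exI[of _ W] exI[of _ A] exI[of _ B] exI[of _ \<phi>]) simp
  qed
  show ?thesis unfolding foliation_on_def using M(1) part pc chart by simp
qed

lemma wedge_coeff_diffeomorphism:
  fixes \<phi> :: "real \<times> real \<Rightarrow> real \<times> real"
  assumes "diffeomorphism_on M P \<phi>" "q \<in> M"
  shows "wedge_coeff (\<lambda>q. fst (\<phi> q)) (\<lambda>q. snd (\<phi> q)) q \<noteq> 0"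
proof
  let ?D = "frechet_derivative \<phi> (at q)"
  let ?E = "frechet_derivative (inv_into M \<phi>) (at (\<phi> q))"
  have M: "open M" "bij_betw \<phi> M P" "smooth_on M \<phi>" "smooth_on P (inv_into M \<phi>)"
    using assms unfolding diffeomorphism_on_def by auto
  have D: "(\<phi> has_derivative ?D) (at q)"
    using smooth_on_differentiable[OF M(3) assms(2)] frechet_derivative_works by blast
  have "\<phi> q \<in> P" using M(2) assms(2) unfolding bij_betw_def by blast
  then have E: "(inv_into M \<phi> has_derivative ?E) (at (\<phi> q))"
    using smooth_on_differentiable[OF M(4)] frechet_derivative_works by blast
  have "((\<lambda>x. inv_into M \<phi> (\<phi> x)) has_derivative (\<lambda>w. ?E (?D w))) (at q)"
    using has_derivative_compose[OF D E] .
  moreover have "((\<lambda>x. inv_into M \<phi> (\<phi> x)) has_derivative (\<lambda>w. w)) (at q)"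
    by (rule has_derivative_transform_within_open[OF has_derivative_ident M(1) assms(2)])
      (use M(2) in \<open>auto simp: bij_betw_def\<close>)
  ultimately have ED: "?E (?D w) = w" for w using has_derivative_unique by metis
  have lin: "linear ?D" "linear ?E"
    using D E by (auto intro: has_derivative_linear)
  have z: "w = 0" if "?D w = 0" for w using ED[of w] that linear_0[OF lin(2)] by simp
  have f: "frechet_derivative (\<lambda>q. fst (\<phi> q)) (at q) = (\<lambda>w. fst (?D w))"
    using frechet_derivative_at[OF has_derivative_fst[OF D]] by simp
  have s: "frechet_derivative (\<lambda>q. snd (\<phi> q)) (at q) = (\<lambda>w. snd (?D w))"
    using frechet_derivative_at[OF has_derivative_snd[OF D]] by simp
  obtain a c where ac: "?D (1, 0) = (a, c)" by fastforce
  obtain b d where bd: "?D (0, 1) = (b, d)" by fastforce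
  have D2: "?D (x, y) = (x * a + y * b, x * c + y * d)" for x y
  proof -
    have "?D (x, y) = ?D (x *\<^sub>R (1, 0) + y *\<^sub>R (0, 1))" by simp
    also have "\<dots> = x *\<^sub>R (a, c) + y *\<^sub>R (b, d)"
      unfolding linear_add[OF lin(1)] linear_scale[OF lin(1)] ac bd ..
    finally show ?thesis by simp
  qed
  assume "wedge_coeff (\<lambda>q. fst (\<phi> q)) (\<lambda>q. snd (\<phi> q)) q = 0"
  then have det: "a * d - b * c = 0" unfolding wedge_coeff_def f s ac bd by simp
  have "?D (d, - c) = 0" "?D (b, - a) = 0"
    unfolding D2 using det by (auto simp: zero_prod_def algebra_simps)
  then have "(d, - c) = 0" "(b, - a) = 0" using z by blast+
  then have "?D (1, 0) = 0" using ac by (simp add: zero_prod_def)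
  then show False using z[of "(1, 0)"] by (simp add: zero_prod_def)
qed

lemma first_integral_on_level_foliation:
  assumes "smooth_on M u" "\<And>q. q \<in> M \<Longrightarrow> frechet_derivative u (at q) \<noteq> (\<lambda>_. 0)"
  shows "first_integral_on M (level_foliation M u) u"
proof -
  have "u q = u r" if "l \<in> level_foliation M u" "path_component (l \<inter> M) q r" for l q r
  proof -
    have "q \<in> l" "r \<in> l" using path_component_mem[OF that(2)] by auto
    then show ?thesis
      using level_foliation_leaf(2)[OF that(1) \<open>q \<in> l\<close>] path_component_subset by fastforce
  qed
  then show ?thesis using assms unfolding first_integral_on_def by blast
qed

lemma lagrangian_web_on_level:
  fixes \<phi> :: "real \<times> real \<Rightarrow> real \<times> real"
  assumes "diffeomorphism_on M P \<phi>"
  shows "lagrangian_web_on M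
           (level_foliation M (\<lambda>q. fst (\<phi> q)), level_foliation M (\<lambda>q. snd (\<phi> q)))"
proof -
  have M: "open M" "smooth_on M \<phi>" using assms unfolding diffeomorphism_on_def by auto
  note w = wedge_coeff_diffeomorphism[OF assms]
  have "first_integral_on M (level_foliation M (\<lambda>q. fst (\<phi> q))) (\<lambda>q. fst (\<phi> q))"
  proof (rule first_integral_on_level_foliation)
    show "smooth_on M (\<lambda>q. fst (\<phi> q))" by (rule smooth_on_linear[OF M(1) bounded_linear_fst M(2)])
    show "frechet_derivative (\<lambda>q. fst (\<phi> q)) (at q) \<noteq> (\<lambda>_. 0)" if "q \<in> M" for q
      using w[OF that] unfolding wedge_coeff_def by auto
  qed
  moreover have "first_integral_on M (level_foliation M (\<lambda>q. snd (\<phi> q))) (\<lambda>q. snd (\<phi> q))"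
  proof (rule first_integral_on_level_foliation)
    show "smooth_on M (\<lambda>q. snd (\<phi> q))" by (rule smooth_on_linear[OF M(1) bounded_linear_snd M(2)])
    show "frechet_derivative (\<lambda>q. snd (\<phi> q)) (at q) \<noteq> (\<lambda>_. 0)" if "q \<in> M" for q
      using w[OF that] unfolding wedge_coeff_def by auto
  qed
  moreover have "foliation_on M (level_foliation M (\<lambda>q. snd (\<phi> q)))"
    using foliation_on_level_fst[OF diffeomorphism_on_swap[OF assms]] by simp
  ultimately show ?thesis
    unfolding lagrangian_web_on_def fst_conv snd_conv
    using foliation_on_level_fst[OF assms] M(1) w by blast
qed

theorem lagrangian_web_on_tangent_web:
  assumes "local_diffeomorphism_on (I \<times> J) (line_meet h)"
    and "open P" "P \<subseteq> I \<times> J" "inj_on (line_meet h) P"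
  shows "lagrangian_web_on (line_meet h ` P) (tangent_web h P)"
  using lagrangian_web_on_level[OF diffeomorphism_on_local_inverse[OF assms]]
  unfolding tangent_web_def comp_def .

end

theory Submission
  imports Defs "HOL-Complex_Analysis.Complex_Analysis"
begin

text \<open>
  With \<open>E(a,b) = h(b) - h(a) - h'(a)(b - a)\<close> the Jacobian determinant of \<open>\<Psi>\<close> is
  \<open>\<rho>(u,v) = E(u,v) E(v,u) / (u - v)\<^sup>3\<close>. It does not vanish on \<open>I \<times> J\<close>, but it extends analytically
  across the diagonal and vanishes there. The Samuelson condition, applied to shrinking squares, gives
  \<open>\<bar>\<rho>(u,v) \<rho>(u',v')\<bar> = \<bar>\<rho>(u,v') \<rho>(u',v)\<bar>\<close> on a small rectangle in \<open>I \<times> J\<close>. By analytic continuation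
  in \<open>v\<close> the squared identity persists for all \<open>v\<close> in \<open>U\<close>; at \<open>v = u\<close> its left-hand side is zero, hence
  \<open>\<rho>(u',u) = 0\<close>. Continuing in \<open>u'\<close> from \<open>I\<close> to \<open>J\<close> contradicts the nonvanishing of \<open>\<rho>\<close>.
\<close>

subsection \<open>Real analytic functions\<close>

text \<open>
  Real analyticity in a form whose stability under products and derivatives and whose identity
  theorem are inherited from the holomorphic case.
\<close>

definition holo_extends :: "real set \<Rightarrow> (real \<Rightarrow> real) \<Rightarrow> bool" where
  "holo_extends S g \<longleftrightarrow>
     (\<forall>t\<in>S. \<exists>r>0. \<exists>f. ball t r \<subseteq> S \<and> f holomorphic_on ball (complex_of_real t) r \<and>
        (\<forall>s\<in>ball t r. f (of_real s) = of_real (g s)))"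

lemma of_real_mem_ball_iff [simp]:
  "complex_of_real s \<in> ball (of_real t) r \<longleftrightarrow> s \<in> ball t r"
  by (simp add: dist_norm flip: of_real_diff)

text \<open>The local power series of \<open>h\<close> at \<open>t\<close> is read with a complex
  argument \<open>w\<close>. If \<open>w\<close> is at distance less than \<open>r\<close> from
  \<open>t\<close>, some real radius \<open>x\<close> lies strictly between that distance and
  \<open>r\<close>; the real series converges at \<open>t + x\<close>, so the complex one converges
  at \<open>w\<close>.\<close>

lemma holo_extends_real_analytic:
  assumes "open U" "real_analytic_on U h"
  shows "holo_extends U h"
  unfolding holo_extends_def
proof
  fix t assume t: "t \<in> U"
  obtain r1 a where r1: "r1 > 0"
      and a: "\<And>s. s \<in> U \<Longrightarrow> \<bar>s - t\<bar> < r1 \<Longrightarrow> (\<lambda>n. a n * (s - t) ^ n) sums h s"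
    using assms(2) t unfolding real_analytic_on_def by blast
  obtain r2 where r2: "r2 > 0" "ball t r2 \<subseteq> U" using assms(1) t open_contains_ball by blast
  define r where "r = min r1 r2"
  have r: "r > 0" "ball t r \<subseteq> U" "r \<le> r1" using r1 r2 unfolding r_def by auto
  have as: "(\<lambda>n. a n * (s - t) ^ n) sums h s" if "s \<in> ball t r" for s
    using that r by (intro a) (auto simp: dist_real_def abs_minus_commute)
  have c: "(\<lambda>n. complex_of_real (a n) * (of_real s - of_real t) ^ n) sums of_real (h s)"
    if "s \<in> ball t r" for s
    using as[OF that] by (simp flip: of_real_diff of_real_power of_real_mult add: sums_of_real_iff)
  define f where "f w = (\<Sum>n. complex_of_real (a n) * (w - of_real t) ^ n)" for w
  have "(\<lambda>n. complex_of_real (a n) * (w - of_real t) ^ n) sums f w"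
    if w: "w \<in> ball (of_real t) r" for w
  proof -
    obtain x where x: "cmod (w - of_real t) < x" "x < r"
      using w dense by (auto simp: dist_norm norm_minus_commute)
    then have "t + x \<in> ball t r" using norm_ge_zero[of "w - of_real t"]
      by (auto simp: dist_real_def simp del: norm_ge_zero)
    from c[OF this] have "summable (\<lambda>n. complex_of_real (a n) * of_real x ^ n)"
      by (simp add: sums_iff)
    moreover have "cmod (w - of_real t) < cmod (of_real x)" using x by simp
    ultimately have "summable (\<lambda>n. complex_of_real (a n) * (w - of_real t) ^ n)"
      by (rule powser_inside)
    then show ?thesis unfolding f_def by (rule summable_sums)
  qed
  then have "f holomorphic_on ball (of_real t) r" by (rule power_series_holomorphic)
  moreover have "f (of_real s) = of_real (h s)" if "s \<in> ball t r" for s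
    using c[OF that] unfolding f_def by (simp add: sums_iff)
  ultimately show "\<exists>r>0. \<exists>f. ball t r \<subseteq> U \<and> f holomorphic_on ball (complex_of_real t) r \<and>
        (\<forall>s\<in>ball t r. f (of_real s) = of_real (h s))"
    using r by blast
qed

lemma holo_extendsE:
  assumes "holo_extends S g" "t \<in> S"
  obtains r f where "r > 0" "ball t r \<subseteq> S" "f holomorphic_on ball (complex_of_real t) r"
    "\<forall>s\<in>ball t r. f (of_real s) = of_real (g s)"
  using assms unfolding holo_extends_def by blast

lemma holo_extends_open: "holo_extends S g \<Longrightarrow> open S"
  unfolding holo_extends_def open_contains_ball by blast

lemma holo_extends_const: "open S \<Longrightarrow> holo_extends S (\<lambda>_. c)"
  unfolding holo_extends_def open_contains_ball
  by (fast intro: holomorphic_on_const)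

lemma holo_extends_ident:
  assumes "open S" shows "holo_extends S (\<lambda>s. s)"
  unfolding holo_extends_def
proof
  fix t assume "t \<in> S"
  then obtain r where "r > 0" "ball t r \<subseteq> S" using assms open_contains_ball by blast
  then show "\<exists>r>0. \<exists>f. ball t r \<subseteq> S \<and> f holomorphic_on ball (complex_of_real t) r \<and>
        (\<forall>s\<in>ball t r. f (of_real s) = of_real s)"
    using holomorphic_on_ident by blast
qed

text \<open>\<open>F\<close> is a complex operation and \<open>G\<close> its real counterpart; the
  two extensions are combined on the smaller disc. Differences, products and powers are instances,
  powers with an \<open>F\<close> that ignores its second argument.\<close>

lemma holo_extends_binop:
  assumes "holo_extends S g" "holo_extends S k"
    and "\<And>A f1 f2. f1 holomorphic_on A \<Longrightarrow> f2 holomorphic_on A \<Longrightarrow> (\<lambda>z. F (f1 z) (f2 z)) holomorphic_on A"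
    and "\<And>x y. F (of_real x) (of_real y) = of_real (G x y)"
  shows "holo_extends S (\<lambda>s. G (g s) (k s))"
  unfolding holo_extends_def
proof
  fix t assume t: "t \<in> S"
  obtain r1 f1 where 1: "r1 > 0" "ball t r1 \<subseteq> S" "f1 holomorphic_on ball (complex_of_real t) r1"
      "\<forall>s\<in>ball t r1. f1 (of_real s) = of_real (g s)"
    by (rule holo_extendsE[OF assms(1) t])
  obtain r2 f2 where 2: "r2 > 0" "ball t r2 \<subseteq> S" "f2 holomorphic_on ball (complex_of_real t) r2"
      "\<forall>s\<in>ball t r2. f2 (of_real s) = of_real (k s)"
    by (rule holo_extendsE[OF assms(2) t])
  define r where "r = min r1 r2"
  have "f1 holomorphic_on ball (of_real t) r" "f2 holomorphic_on ball (of_real t) r"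
    using 1(3) 2(3) by (auto simp: r_def intro: holomorphic_on_subset)
  then have "(\<lambda>z. F (f1 z) (f2 z)) holomorphic_on ball (of_real t) r" by (rule assms(3))
  moreover have "F (f1 (of_real s)) (f2 (of_real s)) = of_real (G (g s) (k s))" if "s \<in> ball t r" for s
    using 1(4) 2(4) that assms(4) unfolding r_def by auto
  moreover have "r > 0" "ball t r \<subseteq> S" using 1 2 unfolding r_def by auto
  ultimately show "\<exists>r>0. \<exists>f. ball t r \<subseteq> S \<and> f holomorphic_on ball (complex_of_real t) r \<and>
        (\<forall>s\<in>ball t r. f (of_real s) = of_real (G (g s) (k s)))" by blast
qed

lemma holo_extends_diff:
  "holo_extends S g \<Longrightarrow> holo_extends S k \<Longrightarrow> holo_extends S (\<lambda>s. g s - k s)"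
  by (rule holo_extends_binop[where F="(-)"]) (auto intro: holomorphic_intros)

lemma holo_extends_mult:
  "holo_extends S g \<Longrightarrow> holo_extends S k \<Longrightarrow> holo_extends S (\<lambda>s. g s * k s)"
  by (rule holo_extends_binop[where F="(*)"]) (auto intro: holomorphic_intros)

lemma holo_extends_power:
  "holo_extends S g \<Longrightarrow> holo_extends S (\<lambda>s. g s ^ n)"
  by (rule holo_extends_binop[where F="\<lambda>x _. x ^ n" and k=g]) (auto intro: holomorphic_intros)

lemmas holo_extends_intros =
  holo_extends_const holo_extends_ident holo_extends_diff holo_extends_mult holo_extends_power

text \<open>On the real axis the local extension \<open>f\<close> takes the real values of
  \<open>g\<close>. Its complex derivative there has imaginary part zero and real part the
  derivative of \<open>g\<close>, so \<open>deriv f\<close> extends \<open>deriv g\<close>.\<close>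

lemma holo_extends_deriv:
  assumes "holo_extends S g"
  shows "\<And>t. t \<in> S \<Longrightarrow> (g has_real_derivative deriv g t) (at t)" and "holo_extends S (deriv g)"
proof -
  have *: "(g has_real_derivative Re (deriv f (of_real s))) (at s) \<and> Im (deriv f (of_real s)) = 0"
    if r: "f holomorphic_on ball (complex_of_real t) r"
      "\<forall>s\<in>ball t r. f (of_real s) = of_real (g s)" and s: "s \<in> ball t r" for f t r s
  proof -
    have "(f has_field_derivative deriv f (of_real s)) (at (of_real s))"
      using r(1) s by (intro holomorphic_derivI[OF _ open_ball]) auto
    then have d: "((\<lambda>x. f (of_real x)) has_vector_derivative deriv f (of_real s)) (at s)"
      by (rule has_vector_derivative_real_field)
    have d': "((\<lambda>x. complex_of_real (g x)) has_vector_derivative deriv f (of_real s)) (at s)"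
      by (rule has_vector_derivative_transform_within_open[OF d open_ball s]) (use r in auto)
    have R: "(g has_vector_derivative Re (deriv f (of_real s))) (at s)"
      using bounded_linear.has_vector_derivative[OF bounded_linear_Re d'] by simp
    have "((\<lambda>_. 0) has_vector_derivative Im (deriv f (of_real s))) (at s)"
      using bounded_linear.has_vector_derivative[OF bounded_linear_Im d'] by simp
    then have "Im (deriv f (of_real s)) = 0"
      using has_vector_derivative_const vector_derivative_unique_at by blast
    then show ?thesis using R by (simp add: has_real_derivative_iff_has_vector_derivative)
  qed
  show "(g has_real_derivative deriv g t) (at t)" if "t \<in> S" for t
  proof -
    obtain r f where "r > 0" "ball t r \<subseteq> S" "f holomorphic_on ball (complex_of_real t) r"
      "\<forall>s\<in>ball t r. f (of_real s) = of_real (g s)"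
      by (rule holo_extendsE[OF assms \<open>t \<in> S\<close>])
    from *[OF this(3,4), of t] this(1) show ?thesis by (metis DERIV_imp_deriv centre_in_ball)
  qed
  show "holo_extends S (deriv g)"
    unfolding holo_extends_def
  proof
    fix t assume t: "t \<in> S"
    obtain r f where f: "r > 0" "ball t r \<subseteq> S" "f holomorphic_on ball (complex_of_real t) r"
      "\<forall>s\<in>ball t r. f (of_real s) = of_real (g s)"
      by (rule holo_extendsE[OF assms t])
    have "deriv f (of_real s) = of_real (deriv g s)" if "s \<in> ball t r" for s
      using *[OF f(3,4) that] by (auto simp: complex_eq_iff dest: DERIV_imp_deriv)
    then show "\<exists>r>0. \<exists>f. ball t r \<subseteq> S \<and> f holomorphic_on ball (complex_of_real t) r \<and>
        (\<forall>s\<in>ball t r. f (of_real s) = of_real (deriv g s))"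
      using f holomorphic_deriv[OF f(3) open_ball] by blast
  qed
qed

lemma holo_extends_continuous_on: "holo_extends S g \<Longrightarrow> continuous_on S g"
  using holo_extends_deriv(1) by (metis DERIV_isCont continuous_at_imp_continuous_on)

text \<open>The set \<open>Z\<close> of points near which \<open>g\<close> vanishes is open, and so
  is its complement in the connected set \<open>U\<close>: if the interval around \<open>s\<close>
  contained a point of \<open>Z\<close>, the extension would vanish on a set with an accumulation
  point, hence on the whole disc, and \<open>s\<close> would lie in \<open>Z\<close>.\<close>

lemma holo_extends_identity:
  assumes g: "holo_extends U g" and "connected U"
    and V: "open V" "V \<noteq> {}" "V \<subseteq> U" "\<And>s. s \<in> V \<Longrightarrow> g s = 0" and t: "t \<in> U"
  shows "g t = 0"
proof -
  define Z where "Z = {s\<in>U. \<exists>W. open W \<and> s \<in> W \<and> (\<forall>x\<in>W. g x = 0)}"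
  have U: "open U" using holo_extends_open[OF g] .
  have "open Z"
  proof -
    have "Z = U \<inter> \<Union>{W. open W \<and> (\<forall>x\<in>W. g x = 0)}" unfolding Z_def by blast
    then show ?thesis using U by auto
  qed
  moreover have "open (U - Z)"
    unfolding open_contains_ball
  proof
    fix s assume s: "s \<in> U - Z"
    then have "s \<in> U" by simp
    then obtain r f where f: "r > 0" "ball s r \<subseteq> U" "f holomorphic_on ball (complex_of_real s) r"
      "\<forall>x\<in>ball s r. f (of_real x) = of_real (g x)"
      by (rule holo_extendsE[OF g])
    have "x \<notin> Z" if x: "x \<in> ball s r" for x
    proof
      assume "x \<in> Z"
      then obtain W where W: "open W" "x \<in> W" "\<And>y. y \<in> W \<Longrightarrow> g y = 0" unfolding Z_def by blast
      let ?W = "W \<inter> ball s r"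
      have "x islimpt ?W"
        using W x by (intro open_imp_islimpt) auto
      then have lp: "of_real x islimpt (complex_of_real ` ?W)"
        by (intro islimpt_isCont_image continuous_intros) (auto simp: eventually_at_filter)
      have z: "f w = 0" if "w \<in> ball (complex_of_real s) r" for w
        by (rule analytic_continuation[OF f(3) open_ball connected_ball _ _ lp _ that])
          (use W x f(4) in auto)
      have "g y = 0" if "y \<in> ball s r" for y
        using z[of "of_real y"] f(4) that by simp
      then have "s \<in> Z" using s f(1) unfolding Z_def by (auto intro!: exI[of _ "ball s r"])
      then show False using s by simp
    qed
    then show "\<exists>e>0. ball s e \<subseteq> U - Z" using f by (intro exI[of _ r]) auto
  qed
  moreover have "Z \<inter> U \<noteq> {}" using V unfolding Z_def by blast
  moreover have "U \<subseteq> Z \<union> (U - Z)" "Z \<inter> (U - Z) \<inter> U = {}" by auto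
  ultimately have "(U - Z) \<inter> U = {}" using connectedD[OF assms(2), of Z "U - Z"] by blast
  then show ?thesis using t unfolding Z_def by auto
qed

subsection \<open>Areas of images in the plane\<close>

lemma vector_2_of_components: "vector [x $ 1, x $ 2] = (x :: real^2)"
  by (simp add: vec_eq_iff forall_2)

text \<open>Areas are taken in \<open>real \<times> real\<close>, while the change of variables
  formula applied below lives on \<open>real^2\<close>. The coordinate map carries one Lebesgue
  measure to the other because both agree on boxes.\<close>

lemma distr_lborel_vec2_prod:
  "distr lborel borel (\<lambda>x :: real^2. (x $ 1, x $ 2)) = (lborel :: (real \<times> real) measure)"
proof (rule lborel_eqI[symmetric])
  let ?T = "\<lambda>x :: real^2. (x $ 1, x $ 2)"
  have T: "?T \<in> borel \<rightarrow>\<^sub>M borel"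
    by (intro borel_measurable_continuous_onI continuous_intros)
  fix l u :: "real \<times> real"
  assume le: "\<And>b. b \<in> Basis \<Longrightarrow> l \<bullet> b \<le> u \<bullet> b"
  have lu: "fst l \<le> fst u" "snd l \<le> snd u"
    using le[of "(1, 0)"] le[of "(0, 1)"] by (auto simp: inner_prod_def Basis_prod_def)
  let ?l = "vector [fst l, snd l] :: real^2" and ?u = "vector [fst u, snd u] :: real^2"
  have "box l u = {fst l<..<fst u} \<times> {snd l<..<snd u}"
    by (subst box_prod) simp
  then have "?T -` box l u = box ?l ?u"
    by (auto simp: mem_box_cart forall_2)
  then have "emeasure (distr lborel borel ?T) (box l u) = emeasure lborel (box ?l ?u)"
    using T by (simp add: emeasure_distr)
  also have "\<dots> = (\<Prod>b\<in>Basis. (?u - ?l) \<bullet> b)"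
    using lu by (intro emeasure_lborel_box) (auto simp: Basis_vec_def inner_axis UNIV_2)
  also have "(\<Prod>b\<in>Basis. (?u - ?l) \<bullet> b) = (fst u - fst l) * (snd u - snd l)"
    by (simp add: Basis_vec_def UNIV_2 inner_axis axis_eq_axis)
  also have "\<dots> = (\<Prod>b\<in>Basis. (u - l) \<bullet> b)"
    by (simp add: Basis_prod_def inner_prod_def)
  finally show "emeasure (distr lborel borel ?T) (box l u) = (\<Prod>b\<in>Basis. (u - l) \<bullet> b)" .
qed simp

text \<open>By change of variables the area of the image is the integral of
  \<open>\<bar>J\<bar>\<close> over \<open>S\<close>; comparison with constant integrands gives both
  bounds. Continuity of \<open>J\<close> up to the closed box makes the integrand
  integrable.\<close>

lemma
  fixes f :: "real \<times> real \<Rightarrow> real \<times> real"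
  assumes ab: "a0 < a1" "b0 < b1"
    and S: "S = {a0<..<a1} \<times> {b0<..<b1}"
    and inj: "inj_on f S" and op: "open (f ` S)"
    and der: "\<And>p. p \<in> S \<Longrightarrow> (f has_derivative f' p) (at p)"
    and J: "\<And>p. p \<in> S \<Longrightarrow> J p = fst (f' p (1, 0)) * snd (f' p (0, 1)) - fst (f' p (0, 1)) * snd (f' p (1, 0))"
    and cont: "continuous_on ({a0..a1} \<times> {b0..b1}) J"
  shows measure_lborel_image_ge:
      "(\<And>p. p \<in> S \<Longrightarrow> c \<le> \<bar>J p\<bar>) \<Longrightarrow> c * ((a1 - a0) * (b1 - b0)) \<le> measure lborel (f ` S)"
    and measure_lborel_image_le:
      "(\<And>p. p \<in> S \<Longrightarrow> \<bar>J p\<bar> \<le> C) \<Longrightarrow> measure lborel (f ` S) \<le> C * ((a1 - a0) * (b1 - b0))"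
proof -
  \<comment> \<open>\<open>T\<close> and \<open>R\<close> are mutually inverse linear
    identifications of \<open>real^2\<close> with the plane. Conjugating \<open>f\<close> by them to
    \<open>F\<close> keeps the Jacobian determinant.\<close>
  define T where "T x = (x $ 1, x $ 2)" for x :: "real^2"
  define R where "R q = (vector [fst q, snd q] :: real^2)" for q :: "real \<times> real"
  have TR: "T (R q) = q" "R (T x) = x" for q x
    unfolding T_def R_def by (simp_all add: vector_2_of_components)
  have blT: "bounded_linear T"
    unfolding T_def by (intro bounded_linear_Pair bounded_linear_vec_nth)
  have blR: "bounded_linear R"
    unfolding R_def by (intro linear_conv_bounded_linear[THEN iffD1] linearI) (simp_all add: vec_eq_iff forall_2)
  define S' where "S' = box (vector [a0, b0] :: real^2) (vector [a1, b1])"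
  define K' where "K' = cbox (vector [a0, b0] :: real^2) (vector [a1, b1])"
  have mem: "x \<in> S' \<longleftrightarrow> T x \<in> S" "x \<in> K' \<longleftrightarrow> T x \<in> {a0..a1} \<times> {b0..b1}" for x
    unfolding S'_def K'_def S T_def by (auto simp: mem_box_cart forall_2)
  define F where "F x = R (f (T x))" for x
  define F' where "F' x w = R (f' (T x) (T w))" for x w
  have derF: "(F has_derivative F' x) (at x within S')" if "x \<in> S'" for x
  proof -
    have "(f has_derivative f' (T x)) (at (T x))" using der mem that by blast
    then have "((\<lambda>x. f (T x)) has_derivative (\<lambda>w. f' (T x) (T w))) (at x)"
      by (rule has_derivative_compose[OF bounded_linear_imp_has_derivative[OF blT]])
    then have "(F has_derivative F' x) (at x)"
      unfolding F_def F'_def by (rule bounded_linear.has_derivative[OF blR])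
    then show ?thesis by (rule has_derivative_at_withinI)
  qed
  have injF: "inj_on F S'"
  proof (rule inj_onI)
    fix x y assume xy: "x \<in> S'" "y \<in> S'" "F x = F y"
    then have "T (R (f (T x))) = T (R (f (T y)))" unfolding F_def by simp
    then have "f (T x) = f (T y)" unfolding TR .
    then have "T x = T y" using inj xy(1,2) mem(1) by (auto dest: inj_onD)
    then have "R (T x) = R (T y)" by simp
    then show "x = y" unfolding TR .
  qed
  have detF: "det (matrix (F' x)) = J (T x)" if "x \<in> S'" for x
  proof -
    have "T (axis 1 1) = (1, 0)" "T (axis 2 1) = (0, 1)" unfolding T_def by (simp_all add: axis_def)
    then show ?thesis
      using J[of "T x"] that mem unfolding det_2 matrix_def F'_def R_def by simp
  qed
  have contT: "continuous_on K' (\<lambda>x. \<bar>J (T x)\<bar>)"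
    by (intro continuous_intros continuous_on_compose2[OF cont] linear_continuous_on[OF blT])
      (use mem in auto)
  have intK: "(\<lambda>x. \<bar>J (T x)\<bar>) integrable_on S'"
    using contT integrable_continuous unfolding S'_def K'_def integrable_on_open_interval by blast
  have "measure lebesgue (F ` S') = integral S' (\<lambda>x. \<bar>det (matrix (F' x))\<bar>)"
  proof (rule measure_differentiable_image_eq[OF _ derF injF])
    show "S' \<in> sets lebesgue" unfolding S'_def by simp
    show "(\<lambda>x. \<bar>det (matrix (F' x))\<bar>) integrable_on S'"
      using intK detF by (simp cong: integrable_cong)
  qed
  also have "\<dots> = integral S' (\<lambda>x. \<bar>J (T x)\<bar>)"
    using detF by (simp cong: integral_cong)
  finally have m1: "measure lebesgue (F ` S') = integral S' (\<lambda>x. \<bar>J (T x)\<bar>)" .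
  have pre: "T -` (f ` S) = F ` S'"
  proof
    show "T -` f ` S \<subseteq> F ` S'"
    proof
      fix x assume "x \<in> T -` f ` S"
      then obtain p where p: "p \<in> S" "T x = f p" by auto
      have "x = R (T x)" unfolding TR ..
      then have "x = F (R p)" unfolding F_def TR(1) p(2) .
      moreover have "R p \<in> S'" unfolding mem(1) TR(1) by (rule p)
      ultimately show "x \<in> F ` S'" by blast
    qed
    show "F ` S' \<subseteq> T -` f ` S"
      using mem(1) unfolding F_def by (auto simp del: TR(2) simp: TR(1)[of "f _"])
  qed
  have "measure lborel (f ` S) = measure (distr lborel borel T) (f ` S)"
    using distr_lborel_vec2_prod unfolding T_def by simp
  also have "\<dots> = measure lborel (F ` S')"
  proof (subst measure_distr)
    show "T \<in> lborel \<rightarrow>\<^sub>M borel"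
      using borel_measurable_continuous_onI[OF linear_continuous_on[OF blT]] by simp
    show "f ` S \<in> sets borel" using op by simp
    show "measure lborel (T -` f ` S \<inter> space lborel) = measure lborel (F ` S')"
      unfolding pre by simp
  qed
  also have "\<dots> = measure lebesgue (F ` S')"
  proof (rule measure_completion[symmetric])
    have "open (T -` (f ` S))" by (intro open_vimage op linear_continuous_on blT)
    then show "F ` S' \<in> sets lborel" using pre by simp
  qed
  finally have m: "measure lborel (f ` S) = integral S' (\<lambda>x. \<bar>J (T x)\<bar>)" using m1 by simp
  have const: "integral S' (\<lambda>_. k) = k * ((a1 - a0) * (b1 - b0))" "(\<lambda>_. k) integrable_on S'" for k :: real
  proof -
    have "integral S' (\<lambda>_. k) = measure lborel (cbox (vector [a0, b0] :: real^2) (vector [a1, b1])) * k"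
      unfolding S'_def integral_open_interval by simp
    also have "measure lborel (cbox (vector [a0, b0] :: real^2) (vector [a1, b1])) = (a1 - a0) * (b1 - b0)"
      using ab by (subst content_cbox_cart) (auto simp: interval_ne_empty_cart forall_2 UNIV_2)
    finally show "integral S' (\<lambda>_. k) = k * ((a1 - a0) * (b1 - b0))" by simp
    show "(\<lambda>_. k) integrable_on S'" unfolding S'_def by (simp add: integrable_on_open_interval integrable_on_const)
  qed
  show "c * ((a1 - a0) * (b1 - b0)) \<le> measure lborel (f ` S)" if "\<And>p. p \<in> S \<Longrightarrow> c \<le> \<bar>J p\<bar>"
    unfolding m const(1)[symmetric] by (intro integral_le const intK) (use that mem in auto)
  show "measure lborel (f ` S) \<le> C * ((a1 - a0) * (b1 - b0))" if "\<And>p. p \<in> S \<Longrightarrow> \<bar>J p\<bar> \<le> C"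
    unfolding m const(1)[symmetric] by (intro integral_le const intK) (use that mem in auto)
qed

text \<open>Positivity: \<open>\<bar>J\<bar>\<close> has a positive minimum on the compact box.
  Limit: on a small square \<open>\<bar>J\<bar>\<close> stays within \<open>\<epsilon> / 2\<close>
  of its value at the lower left corner, and the area bounds are divided by
  \<open>e\<^sup>2\<close>.\<close>

lemma
  fixes f :: "real \<times> real \<Rightarrow> real \<times> real"
  defines "m \<equiv> \<lambda>a a' b b'. measure lborel (f ` ({a<..<a'} \<times> {b<..<b'}))"
  assumes P: "open P" "inj_on f P"
    and der: "\<And>p. p \<in> P \<Longrightarrow> (f has_derivative f' p) (at p)"
    and J: "\<And>p. p \<in> P \<Longrightarrow> J p = fst (f' p (1, 0)) * snd (f' p (0, 1)) - fst (f' p (0, 1)) * snd (f' p (1, 0))"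
    and cont: "continuous_on P J"
  shows measure_image_box_pos:
      "\<And>a a' b b'. a < a' \<Longrightarrow> b < b' \<Longrightarrow> {a..a'} \<times> {b..b'} \<subseteq> P \<Longrightarrow> (\<And>p. p \<in> P \<Longrightarrow> J p \<noteq> 0) \<Longrightarrow> m a a' b b' > 0"
    and measure_image_square_tendsto:
      "\<And>a b. (a, b) \<in> P \<Longrightarrow> ((\<lambda>e. m a (a + e) b (b + e) / e\<^sup>2) \<longlongrightarrow> \<bar>J (a, b)\<bar>) (at_right 0)"
proof -
  have contf: "continuous_on P f"
    using der by (intro has_derivative_continuous_on) (blast intro: has_derivative_at_withinI)
  have ge: "c * ((a' - a) * (b' - b)) \<le> m a a' b b'" and le: "m a a' b b' \<le> C * ((a' - a) * (b' - b))"
    if ab: "a < a'" "b < b'" "{a..a'} \<times> {b..b'} \<subseteq> P"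
      and cC: "\<And>p. p \<in> {a<..<a'} \<times> {b<..<b'} \<Longrightarrow> c \<le> \<bar>J p\<bar> \<and> \<bar>J p\<bar> \<le> C" for a a' b b' c C
  proof -
    let ?S = "{a<..<a'} \<times> {b<..<b'}"
    have "?S \<subseteq> {a..a'} \<times> {b..b'}" by (intro Sigma_mono) auto
    then have SP: "?S \<subseteq> P" using ab(3) by (rule subset_trans)
    have inj: "inj_on f ?S" using P(2) SP by (rule inj_on_subset)
    have op: "open (f ` ?S)"
      using continuous_on_subset[OF contf SP] inj
      by (intro invariance_of_domain) (auto intro: open_Times)
    have "p \<in> P" if "p \<in> ?S" for p using SP that by (rule subsetD)
    note * = ab(1,2) refl inj op der[OF this] J[OF this] continuous_on_subset[OF cont ab(3)]
    show "c * ((a' - a) * (b' - b)) \<le> m a a' b b'"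
      unfolding m_def by (rule measure_lborel_image_ge[OF *]) (use cC in auto)
    show "m a a' b b' \<le> C * ((a' - a) * (b' - b))"
      unfolding m_def by (rule measure_lborel_image_le[OF *]) (use cC in auto)
  qed
  show "m a a' b b' > 0"
    if ab: "a < a'" "b < b'" "{a..a'} \<times> {b..b'} \<subseteq> P" and nz: "\<And>p. p \<in> P \<Longrightarrow> J p \<noteq> 0" for a a' b b'
  proof -
    let ?K = "{a..a'} \<times> {b..b'}"
    have K: "compact ?K" "?K \<noteq> {}" "continuous_on ?K (\<lambda>p. \<bar>J p\<bar>)"
      using ab continuous_on_subset[OF cont ab(3)]
      by (auto intro: compact_Times continuous_intros)
    obtain p where p: "p \<in> ?K" "\<And>q. q \<in> ?K \<Longrightarrow> \<bar>J p\<bar> \<le> \<bar>J q\<bar>"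
      using continuous_attains_inf[OF K] by blast
    \<comment> \<open>The maximum at \<open>p'\<close> supplies the upper constant in the common
      hypothesis of \<open>ge\<close> and \<open>le\<close>.\<close>
    obtain p' where p': "p' \<in> ?K" "\<And>q. q \<in> ?K \<Longrightarrow> \<bar>J q\<bar> \<le> \<bar>J p'\<bar>"
      using continuous_attains_sup[OF K] by blast
    have "0 < \<bar>J p\<bar> * ((a' - a) * (b' - b))" using nz[of p] p(1) ab by auto
    also have "\<dots> \<le> m a a' b b'" by (rule ge[OF ab, where c="\<bar>J p\<bar>" and C="\<bar>J p'\<bar>"]) (use p(2) p'(2) in auto)
    finally show ?thesis .
  qed
  show "((\<lambda>e. m a (a + e) b (b + e) / e\<^sup>2) \<longlongrightarrow> \<bar>J (a, b)\<bar>) (at_right 0)" if ab: "(a, b) \<in> P" for a b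
  proof (rule tendstoI)
    fix \<epsilon> :: real assume \<epsilon>: "\<epsilon> > 0"
    \<comment> \<open>The estimates for the quotient will be non-strict;
      \<open>\<epsilon> / 2\<close> leaves room for the strict inequality in the end.\<close>
    have "open (P \<inter> J -` ball (J (a, b)) (\<epsilon> / 2))"
      using continuous_open_preimage[OF cont P(1) open_ball] .
    moreover have "(a, b) \<in> P \<inter> J -` ball (J (a, b)) (\<epsilon> / 2)" using ab \<epsilon> by simp
    ultimately obtain A B where AB: "open A" "open B" "(a, b) \<in> A \<times> B"
        "A \<times> B \<subseteq> P \<inter> J -` ball (J (a, b)) (\<epsilon> / 2)"
      by (rule open_prod_elim)
    obtain ra where ra: "ra > 0" "ball a ra \<subseteq> A" using openE[OF AB(1)] AB(3) by blast
    obtain rb where rb: "rb > 0" "ball b rb \<subseteq> B" using openE[OF AB(2)] AB(3) by blast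
    have "eventually (\<lambda>e. e \<in> {0<..<min ra rb}) (at_right 0)"
      using ra rb by (intro eventually_at_right_real) auto
    then show "eventually (\<lambda>e. dist (m a (a + e) b (b + e) / e\<^sup>2) \<bar>J (a, b)\<bar> < \<epsilon>) (at_right 0)"
    proof eventually_elim
      case (elim e)
      have "{a..a+e} \<subseteq> ball a ra" "{b..b+e} \<subseteq> ball b rb"
        using elim by (auto simp: dist_real_def)
      then have "{a..a+e} \<times> {b..b+e} \<subseteq> A \<times> B" using ra rb by (intro Sigma_mono) auto
      then have sub: "{a..a+e} \<times> {b..b+e} \<subseteq> P \<inter> J -` ball (J (a, b)) (\<epsilon> / 2)"
        using AB(4) by (rule subset_trans)
      then have subP: "{a..a+e} \<times> {b..b+e} \<subseteq> P" by blast
      have bd: "\<bar>J (a, b)\<bar> - \<epsilon> / 2 \<le> \<bar>J p\<bar> \<and> \<bar>J p\<bar> \<le> \<bar>J (a, b)\<bar> + \<epsilon> / 2"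
        if "p \<in> {a<..<a+e} \<times> {b<..<b+e}" for p
      proof -
        have "p \<in> {a..a+e} \<times> {b..b+e}" using that by auto
        then have "dist (J (a, b)) (J p) < \<epsilon> / 2" using sub by auto
        then show ?thesis unfolding dist_real_def by linarith
      qed
      have "(\<bar>J (a, b)\<bar> - \<epsilon> / 2) * e\<^sup>2 \<le> m a (a + e) b (b + e)"
        using ge[OF _ _ subP bd] elim by (simp add: power2_eq_square)
      moreover have "m a (a + e) b (b + e) \<le> (\<bar>J (a, b)\<bar> + \<epsilon> / 2) * e\<^sup>2"
        using le[OF _ _ subP bd] elim by (simp add: power2_eq_square)
      moreover have "e\<^sup>2 > 0" using elim by simp
      ultimately have "\<bar>J (a, b)\<bar> - \<epsilon> / 2 \<le> m a (a + e) b (b + e) / e\<^sup>2"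
        "m a (a + e) b (b + e) / e\<^sup>2 \<le> \<bar>J (a, b)\<bar> + \<epsilon> / 2"
        by (simp_all add: pos_le_divide_eq pos_divide_le_eq)
      then show ?case using \<epsilon> by (simp add: dist_real_def abs_le_iff)
    qed
  qed
qed

subsection \<open>The Jacobian of the intersection map\<close>

text \<open>The first-order Taylor remainder of \<open>h\<close> at \<open>a\<close>: the signed
  height at \<open>b\<close> of the graph over its tangent line at \<open>a\<close>.\<close>

definition tangent_gap :: "(real \<Rightarrow> real) \<Rightarrow> real \<Rightarrow> real \<Rightarrow> real" where
  "tangent_gap h a b = h b - h a - deriv h a * (b - a)"

text \<open>
  The Jacobian determinant of \<^const>\<open>line_meet\<close> off the diagonal. The numerator vanishes to order at least four
  on the diagonal \<open>u = v\<close> and the denominator only to order three.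
\<close>

definition meet_jacobian :: "(real \<Rightarrow> real) \<Rightarrow> real \<times> real \<Rightarrow> real" where
  "meet_jacobian h = (\<lambda>(u, v). tangent_gap h u v * tangent_gap h v u / (u - v) ^ 3)"

text \<open>Here \<open>x\<close> is the abscissa of the intersection point, \<open>dx\<close> its
  variation by the quotient rule, and the second component the variation of the ordinate
  \<open>u * x + h u\<close>.\<close>

definition meet_deriv :: "(real \<Rightarrow> real) \<Rightarrow> real \<times> real \<Rightarrow> real \<times> real \<Rightarrow> real \<times> real" where
  "meet_deriv h = (\<lambda>(u, v) (s, t).
     let x = (h v - h u) / (u - v);
         dx = (deriv h v * t - deriv h u * s - x * (s - t)) / (u - v)
     in (dx, s * x + u * dx + deriv h u * s))"

lemma line_meet_has_derivative:
  assumes "(h has_real_derivative deriv h u) (at u)" "(h has_real_derivative deriv h v) (at v)" "u \<noteq> v"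
  shows "(line_meet h has_derivative meet_deriv h (u, v)) (at (u, v))"
proof -
  let ?x = "\<lambda>p. (h (snd p) - h (fst p)) / (fst p - snd p)"
  have hu: "(h has_derivative (\<lambda>s. deriv h u * s)) (at (fst (u, v)))"
    and hv: "(h has_derivative (\<lambda>s. deriv h v * s)) (at (snd (u, v)))"
    using assms by (simp_all add: has_field_derivative_def)
  note hu' = has_derivative_compose[OF has_derivative_fst[OF has_derivative_ident] hu]
  note hv' = has_derivative_compose[OF has_derivative_snd[OF has_derivative_ident] hv]
  let ?x' = "\<lambda>w. ((deriv h v * snd w - deriv h u * fst w) * (u - v) -
      (h v - h u) * (fst w - snd w)) / ((u - v) * (u - v))"
  have "(?x has_derivative ?x') (at (u, v))"
    using has_derivative_divide'[OF has_derivative_diff[OF hv' hu']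
        has_derivative_diff[OF has_derivative_fst[OF has_derivative_ident]
          has_derivative_snd[OF has_derivative_ident]]] assms(3) by simp
  from has_derivative_Pair[OF this has_derivative_add[OF has_derivative_mult
      [OF has_derivative_fst[OF has_derivative_ident] this] hu']]
  have "((\<lambda>p. (?x p, fst p * ?x p + h (fst p))) has_derivative
      (\<lambda>w. (?x' w, u * ?x' w + fst w * ((h v - h u) / (u - v)) + deriv h u * fst w))) (at (u, v))"
    by simp
  also have "(\<lambda>w. (?x' w, u * ?x' w + fst w * ((h v - h u) / (u - v)) + deriv h u * fst w)) =
      meet_deriv h (u, v)"
  proof
    fix w :: "real \<times> real"
    have "(A * d - m * k) / (d * d) = (A - m / d * k) / d" if "d \<noteq> 0" for A d m k :: real
      using that by (simp add: field_simps)
    then have "?x' w = (deriv h v * snd w - deriv h u * fst w - (h v - h u) / (u - v) * (fst w - snd w)) / (u - v)"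
      using assms(3) by simp
    then show "(?x' w, u * ?x' w + fst w * ((h v - h u) / (u - v)) + deriv h u * fst w) =
        meet_deriv h (u, v) w"
      unfolding meet_deriv_def Let_def by (simp add: split_beta)
  qed
  finally have "((\<lambda>p. (?x p, fst p * ?x p + h (fst p))) has_derivative meet_deriv h (u, v)) (at (u, v))" .
  \<comment> \<open>\<open>line_meet\<close> is given by a definite description and agrees with the
    explicit formula off the diagonal; that region is open, so the derivative carries over.\<close>
  moreover have "open {p :: real \<times> real. fst p \<noteq> snd p}"
    by (intro open_Collect_neq continuous_intros)
  ultimately show ?thesis
    by (rule has_derivative_transform_within_open) (use assms(3) line_meet_eq(2) in auto)
qed

lemma meet_jacobian_eq:
  assumes "u \<noteq> v"
  shows "meet_jacobian h (u, v) =
    fst (meet_deriv h (u, v) (1, 0)) * snd (meet_deriv h (u, v) (0, 1)) -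
    fst (meet_deriv h (u, v) (0, 1)) * snd (meet_deriv h (u, v) (1, 0))"
proof -
  \<comment> \<open>In terms of \<open>d\<close> and the negative slope \<open>x\<close> of the
    chord, \<open>h v\<close> becomes \<open>h u + x * d\<close>. After clearing powers of
    \<open>d\<close> a polynomial identity remains.\<close>
  define d x where "d = u - v" and "x = (h v - h u) / d"
  have d: "d \<noteq> 0" "u - v = d" "v - u = - d" "h v = h u + x * d" using assms by (auto simp: d_def x_def)
  show ?thesis
    unfolding meet_jacobian_def meet_deriv_def tangent_gap_def Let_def prod.case d fst_conv snd_conv
    using d(1) by (simp add: divide_simps) algebra
qed

lemma continuous_on_meet_jacobian:
  assumes "holo_extends U h" and IJ: "I \<subseteq> U" "J \<subseteq> U" "I \<inter> J = {}"
  shows "continuous_on (I \<times> J) (meet_jacobian h)"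
proof -
  have "continuous_on U h" "continuous_on U (deriv h)"
    using holo_extends_continuous_on assms(1) holo_extends_deriv(2) by blast+
  note * = continuous_on_compose2[OF this(1)] continuous_on_compose2[OF this(2)]
  have "continuous_on (I \<times> J) (\<lambda>p. (h (snd p) - h (fst p) - deriv h (fst p) * (snd p - fst p)) *
      (h (fst p) - h (snd p) - deriv h (snd p) * (fst p - snd p)) / (fst p - snd p) ^ 3)"
    by (intro continuous_intros *) (use IJ in auto)
  then show ?thesis unfolding meet_jacobian_def tangent_gap_def by (simp add: case_prod_unfold)
qed

text \<open>A local diffeomorphism has a differentiable local inverse, so its differential is
  invertible; the determinant of that differential is \<open>wedge_coeff\<close> of the two
  components.\<close>

lemma meet_jacobian_nonzero:
  assumes "local_diffeomorphism_on S (line_meet h)" "(u, v) \<in> S" "u \<noteq> v"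
    and "(h has_real_derivative deriv h u) (at u)" "(h has_real_derivative deriv h v) (at v)"
  shows "meet_jacobian h (u, v) \<noteq> 0"
proof -
  obtain W where W: "(u, v) \<in> W" "diffeomorphism_on W (line_meet h ` W) (line_meet h)"
    using assms(1,2) unfolding local_diffeomorphism_on_def by blast
  note d = line_meet_has_derivative[OF assms(4,5,3)]
  have "wedge_coeff (\<lambda>q. fst (line_meet h q)) (\<lambda>q. snd (line_meet h q)) (u, v) = meet_jacobian h (u, v)"
    unfolding wedge_coeff_def meet_jacobian_eq[OF assms(3)]
      frechet_derivative_at[OF has_derivative_fst[OF d], symmetric]
      frechet_derivative_at[OF has_derivative_snd[OF d], symmetric] ..
  then show ?thesis using wedge_coeff_diffeomorphism[OF W(2,1)] by simp
qed

section \<open>Vanishing on the diagonal and analytic continuation to it\<close>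

lemma holo_extends_tangent_gap:
  assumes "holo_extends U h"
  shows "holo_extends U (\<lambda>b. tangent_gap h a b)" "holo_extends U (\<lambda>a. tangent_gap h a b)"
proof -
  note * = holo_extends_intros
    holo_extends_deriv(2)[OF assms] holo_extends_open[OF assms] assms
  show "holo_extends U (\<lambda>b. tangent_gap h a b)" "holo_extends U (\<lambda>a. tangent_gap h a b)"
    unfolding tangent_gap_def by (intro *)+
qed

text \<open>The second derivative of \<open>h\<close> is bounded by some \<open>C\<close> on the
  compact interval. The mean value inequality, used first for \<open>deriv h\<close> and then for
  the gap in its second argument, yields the quadratic bound.\<close>

lemma tangent_gap_bound:
  assumes h: "holo_extends U h" and pq: "{p..q} \<subseteq> U"
  obtains C where "C \<ge> 0" "\<And>a b. a \<in> {p..q} \<Longrightarrow> b \<in> {p..q} \<Longrightarrow> \<bar>tangent_gap h a b\<bar> \<le> C * (b - a)\<^sup>2"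
proof -
  note h' = holo_extends_deriv[OF h] and h'' = holo_extends_deriv[OF holo_extends_deriv(2)[OF h]]
  have "bounded (deriv (deriv h) ` {p..q})"
    using holo_extends_continuous_on[OF h''(2)] pq
    by (intro compact_imp_bounded compact_continuous_image) (auto intro: continuous_on_subset)
  then obtain C where C: "C > 0" "\<And>s. s \<in> {p..q} \<Longrightarrow> \<bar>deriv (deriv h) s\<bar> \<le> C"
    unfolding bounded_pos by auto
  have "\<bar>tangent_gap h a b\<bar> \<le> C * (b - a)\<^sup>2" if ab: "a \<in> {p..q}" "b \<in> {p..q}" for a b
  proof -
    let ?s = "closed_segment a b"
    have s: "?s \<subseteq> {p..q}" using ab by (intro closed_segment_subset) auto
    have 1: "\<bar>deriv h x - deriv h a\<bar> \<le> C * \<bar>x - a\<bar>" if "x \<in> ?s" for x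
    proof -
      have "norm (deriv h x - deriv h a) \<le> C * norm (x - a)"
      proof (rule field_differentiable_bound[of ?s "deriv h" "deriv (deriv h)"])
        fix z assume "z \<in> ?s"
        then have z: "z \<in> {p..q}" "z \<in> U" using s pq by auto
        show "(deriv h has_real_derivative deriv (deriv h) z) (at z within ?s)"
          using h''(1)[OF z(2)] by (rule has_field_derivative_at_within)
        show "norm (deriv (deriv h) z) \<le> C" using C(2)[OF z(1)] by simp
      qed (use that in auto)
      then show ?thesis by simp
    qed
    \<comment> \<open>The gap vanishes at \<open>b = a\<close>, and its derivative in the second
      argument is \<open>deriv h x - deriv h a\<close>, just bounded on the segment.\<close>
    have "norm (tangent_gap h a b - tangent_gap h a a) \<le> (C * \<bar>b - a\<bar>) * norm (b - a)"
    proof (rule field_differentiable_bound[of ?s _ "\<lambda>x. deriv h x - deriv h a"])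
      fix x assume x: "x \<in> ?s"
      then have "x \<in> U" using s pq by auto
      then show "(tangent_gap h a has_real_derivative deriv h x - deriv h a) (at x within ?s)"
        unfolding tangent_gap_def[abs_def]
        by (auto intro!: derivative_eq_intros has_field_derivative_at_within[OF h'(1)])
      have "\<bar>x - a\<bar> \<le> \<bar>b - a\<bar>" using x by (auto simp: closed_segment_eq_real_ivl split: if_splits)
      then show "norm (deriv h x - deriv h a) \<le> C * \<bar>b - a\<bar>"
        using 1[OF x] C(1) by (smt (verit) mult_left_mono real_norm_def)
    qed auto
    then show ?thesis by (simp add: tangent_gap_def power2_eq_square abs_mult_self_eq mult.assoc)
  qed
  then show ?thesis using that[of C] C by auto
qed

text \<open>
  Both sides of the product identity are squared, so that neither the sign of \<open>u - v\<close> nor that of the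
  Jacobian matters, and multiplied by the denominators, so that they are analytic across the diagonal.
\<close>

lemma not_product_jacobian:
  assumes h: "holo_extends U h" and U: "is_interval U"
    and IJ: "open I" "I \<noteq> {}" "I \<subseteq> U" "open J" "J \<noteq> {}" "J \<subseteq> U" "I \<inter> J = {}"
    and nz: "\<And>u v. u \<in> I \<Longrightarrow> v \<in> J \<Longrightarrow> meet_jacobian h (u, v) \<noteq> 0"
    and eq: "\<And>u u' v v'. u \<in> I \<Longrightarrow> u' \<in> I \<Longrightarrow> u < u' \<Longrightarrow> v \<in> J \<Longrightarrow> v' \<in> J \<Longrightarrow> v < v' \<Longrightarrow>
      \<bar>meet_jacobian h (u, v) * meet_jacobian h (u', v')\<bar> =
      \<bar>meet_jacobian h (u, v') * meet_jacobian h (u', v)\<bar>"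
  shows False
proof -
  \<comment> \<open>The numerator of the Jacobian. Unlike the quotient it is analytic in each
    variable on all of \<open>U\<close>, diagonal included.\<close>
  define H where "H a b = tangent_gap h a b * tangent_gap h b a" for a b
  have H: "holo_extends U (\<lambda>b. H a b)" "holo_extends U (\<lambda>a. H a b)" for a b
    unfolding H_def by (intro holo_extends_mult holo_extends_tangent_gap[OF h])+
  have oU: "open U" and cU: "connected U"
    using holo_extends_open[OF h] U by (auto simp: is_interval_connected_1)
  have JH: "meet_jacobian h (a, b) = H a b / (a - b) ^ 3" for a b
    unfolding meet_jacobian_def H_def by simp
  have Hnz: "H a b \<noteq> 0" if "a \<in> I" "b \<in> J" for a b
    using nz[OF that] unfolding JH by auto
  have Hsym: "H a b = H b a" for a b unfolding H_def by simp
  obtain u where u: "u \<in> I" using IJ by blast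
  obtain v' where v': "v' \<in> J" using IJ by blast
  have above: "\<exists>x\<in>S. s < x" and below: "\<exists>x\<in>S. x < s" if S: "open S" "s \<in> S" for s :: real and S
  proof -
    obtain e where e: "e > 0" "ball s e \<subseteq> S" by (rule openE[OF S])
    have "s + e/2 \<in> ball s e" "s - e/2 \<in> ball s e" using e(1) by (simp_all add: dist_real_def)
    then have mem: "s + e/2 \<in> S" "s - e/2 \<in> S" by (auto intro: subsetD[OF e(2)])
    show "\<exists>x\<in>S. s < x" using e(1) by (intro bexI[OF _ mem(1)]) simp
    show "\<exists>x\<in>S. x < s" using e(1) by (intro bexI[OF _ mem(2)]) simp
  qed
  \<comment> \<open>With \<open>u\<close>, \<open>u'\<close> and \<open>v'\<close> fixed, the
    squared identity is continued in \<open>v\<close> from \<open>J\<close> to \<open>U\<close>, and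
    then \<open>v\<close> tends to \<open>u\<close>.\<close>
  have zero: "H u' u = 0" if u': "u' \<in> I" "u < u'" for u'
  proof -
    \<comment> \<open>After cross-multiplication the two sides of the squared identity are
      \<open>(H u v)\<^sup>2 * M v\<close> and \<open>k v * (u - v) ^ 6\<close>. The factors
      \<open>H u v\<close> and \<open>u - v\<close> are kept apart because both vanish at
      \<open>v = u\<close>.\<close>
    define k where "k v = (H u v')\<^sup>2 * (H u' v)\<^sup>2 * (u' - v') ^ 6" for v
    define M where "M v = (H u' v')\<^sup>2 * (u - v') ^ 6 * (u' - v) ^ 6" for v
    have ne: "u \<noteq> v'" "u' \<noteq> v'" using u u' v' IJ(7) by auto
    have cross: "(H u v)\<^sup>2 * M v - k v * (u - v) ^ 6 = 0" if v: "v \<in> J" "v < v'" for v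
    proof -
      have d: "u \<noteq> v" "u' \<noteq> v" using u u' v IJ(7) by auto
      have sq: "(a * b * (r * s))\<^sup>2 = (c * d * (p * q))\<^sup>2"
        if "\<bar>a / p * (b / q)\<bar> = \<bar>c / r * (d / s)\<bar>" "p \<noteq> 0" "q \<noteq> 0" "r \<noteq> 0" "s \<noteq> 0"
        for a b c d p q r s :: real
      proof -
        have "\<bar>a * b * (r * s)\<bar> = \<bar>a / p * (b / q)\<bar> * \<bar>p * q * r * s\<bar>"
          using that(2-) by (simp add: abs_mult)
        also have "\<dots> = \<bar>c * d * (p * q)\<bar>"
          unfolding that(1) using that(2-) by (simp add: abs_mult)
        finally show ?thesis by (simp only: power2_eq_iff abs_eq_iff)
      qed
      have "(H u v * H u' v' * ((u - v') ^ 3 * (u' - v) ^ 3))\<^sup>2 =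
          (H u v' * H u' v * ((u - v) ^ 3 * (u' - v') ^ 3))\<^sup>2"
        using d ne eq[OF u u' v(1) v' v(2)] unfolding JH by (intro sq) auto
      then show ?thesis
        unfolding M_def k_def power_mult_distrib power_mult[symmetric] by (simp add: mult_ac)
    qed
    have Mk: "holo_extends U M" "holo_extends U k"
      unfolding M_def k_def by (intro holo_extends_intros H oU)+
    \<comment> \<open>The continuation starts from the part of \<open>J\<close> below
      \<open>v'\<close>, since the product identity is given for \<open>v < v'\<close>.\<close>
    have cross': "(H u v)\<^sup>2 * M v = k v * (u - v) ^ 6" if "v \<in> U" for v
    proof -
      have "(H u v)\<^sup>2 * M v - k v * (u - v) ^ 6 = 0"
      proof (rule holo_extends_identity[OF _ cU _ _ _ cross that])
        show "holo_extends U (\<lambda>v. (H u v)\<^sup>2 * M v - k v * (u - v) ^ 6)"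
          by (intro holo_extends_intros H oU Mk)
        show "open (J \<inter> {..<v'})" using IJ(4) by (intro open_Int open_lessThan)
        show "J \<inter> {..<v'} \<noteq> {}" using below[OF IJ(4) v'] by blast
        show "J \<inter> {..<v'} \<subseteq> U" using IJ(6) by blast
      qed auto
      then show ?thesis by simp
    qed
    obtain e where e: "e > 0" "{u - e..u + e} \<subseteq> U"
    proof -
      obtain e where "e > 0" "cball u e \<subseteq> U" using oU u IJ open_contains_cball by blast
      then show ?thesis using that by (simp add: cball_eq_atLeastAtMost)
    qed
    obtain C where C: "C \<ge> 0" "\<And>a b. a \<in> {u-e..u+e} \<Longrightarrow> b \<in> {u-e..u+e} \<Longrightarrow> \<bar>tangent_gap h a b\<bar> \<le> C * (b - a)\<^sup>2"
      using tangent_gap_bound[OF h e(2)] by blast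
    \<comment> \<open>\<open>(H u v)\<^sup>2\<close> is at most \<open>C ^ 4 * (u - v) ^ 8\<close>.
      Cancelling the sixth power leaves a factor \<open>(u - v)\<^sup>2\<close>, which still tends
      to zero.\<close>
    have le: "k v \<le> C ^ 4 * (u - v)\<^sup>2 * M v" if v: "v \<in> {u-e..u+e}" "v \<noteq> u" for v
    proof -
      have "\<bar>H u v\<bar> \<le> (C * (v - u)\<^sup>2) * (C * (u - v)\<^sup>2)"
        unfolding H_def abs_mult using C v e(1) by (intro mult_mono) auto
      then have "(H u v)\<^sup>2 \<le> ((C * (v - u)\<^sup>2) * (C * (u - v)\<^sup>2))\<^sup>2"
        by (rule abs_le_square_iff[THEN iffD1, OF order_trans]) simp
      also have "\<dots> = C ^ 4 * (u - v)\<^sup>2 * (u - v) ^ 6"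
      proof -
        have "((C * d\<^sup>2) * (C * d\<^sup>2))\<^sup>2 = C ^ 4 * d\<^sup>2 * d ^ 6" for d :: real
          by (simp add: numeral_eq_Suc mult_ac)
        then show ?thesis by (simp add: power2_commute[of v u])
      qed
      finally have "(H u v)\<^sup>2 * M v \<le> C ^ 4 * (u - v)\<^sup>2 * (u - v) ^ 6 * M v"
        by (intro mult_right_mono) (auto simp: M_def)
      then have "k v * (u - v) ^ 6 \<le> (C ^ 4 * (u - v)\<^sup>2 * M v) * (u - v) ^ 6"
        using cross'[of v] v e(2) by (simp add: subset_iff mult.assoc mult.left_commute mult.commute)
      moreover have "(u - v) ^ 6 > 0" using v by (simp add: zero_less_power_eq)
      ultimately show ?thesis by simp
    qed
    have cont: "isCont k u" "isCont M u"
      using Mk[THEN holo_extends_continuous_on] oU u IJ(3) by (auto simp: continuous_on_eq_continuous_at)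
    \<comment> \<open>Passing to the limit gives \<open>k u \<le> 0\<close>. But \<open>k u\<close>
      is a product of even powers in which every factor other than \<open>H u' u\<close> is
      nonzero.\<close>
    have "k u \<le> C ^ 4 * (u - u)\<^sup>2 * M u"
    proof (rule tendsto_le)
      show "((\<lambda>v. C ^ 4 * (u - v)\<^sup>2 * M v) \<longlongrightarrow> C ^ 4 * (u - u)\<^sup>2 * M u) (at u)"
        using cont(2) by (intro tendsto_intros) (simp add: isCont_def)
      show "(k \<longlongrightarrow> k u) (at u)" using cont(1) by (simp add: isCont_def)
      have "eventually (\<lambda>v. v \<in> {u-e<..<u+e}) (at u)"
        using e(1) by (intro eventually_at_in_open') auto
      moreover have "eventually (\<lambda>v. v \<noteq> u) (at u)" by (rule eventually_neq_at_within)
      ultimately show "eventually (\<lambda>v. k v \<le> C ^ 4 * (u - v)\<^sup>2 * M v) (at u)"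
        by eventually_elim (rule le, auto)
    qed simp
    then have "(H u v')\<^sup>2 * (H u' u)\<^sup>2 * (u' - v') ^ 6 \<le> 0" unfolding k_def by simp
    moreover have "0 \<le> (H u v')\<^sup>2 * (H u' u)\<^sup>2 * (u' - v') ^ 6" by simp
    ultimately have "(H u v')\<^sup>2 * (H u' u)\<^sup>2 * (u' - v') ^ 6 = 0" by linarith
    then show ?thesis using Hnz[OF u v'] ne by simp
  qed
  \<comment> \<open>The zeros found for first arguments in \<open>I\<close> above \<open>u\<close>
    are continued in that variable to the point \<open>v'\<close> of \<open>J\<close>; symmetry of
    \<open>H\<close> then contradicts \<open>Hnz\<close>.\<close>
  have "H v' u = 0"
  proof (rule holo_extends_identity[OF H(2)[of u] cU])
    show "open (I \<inter> {u<..})" using IJ(1) by (intro open_Int open_greaterThan)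
    show "I \<inter> {u<..} \<noteq> {}" using above[OF IJ(1) u] by blast
    show "I \<inter> {u<..} \<subseteq> U" "v' \<in> U" using IJ(3,6) v' by blast+
    show "H s u = 0" if "s \<in> I \<inter> {u<..}" for s using zero that by simp
  qed
  then show False using Hnz[OF u v'] Hsym by simp
qed

subsection \<open>The Samuelson condition\<close>

text \<open>
  The Samuelson condition only compares adjacent quadrilaterals; this passes to two columns and two
  rows that are separated by a third one.
\<close>

lemma cross_ratio_grid:
  fixes x\<^sub>1\<^sub>1 :: "'a :: idom"
  assumes "x\<^sub>1\<^sub>1 * x\<^sub>2\<^sub>2 = x\<^sub>1\<^sub>2 * x\<^sub>2\<^sub>1" "x\<^sub>1\<^sub>2 * x\<^sub>2\<^sub>3 = x\<^sub>1\<^sub>3 * x\<^sub>2\<^sub>2"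
    and "x\<^sub>2\<^sub>1 * x\<^sub>3\<^sub>2 = x\<^sub>2\<^sub>2 * x\<^sub>3\<^sub>1" "x\<^sub>2\<^sub>2 * x\<^sub>3\<^sub>3 = x\<^sub>2\<^sub>3 * x\<^sub>3\<^sub>2" and "x\<^sub>2\<^sub>2 \<noteq> 0"
  shows "x\<^sub>1\<^sub>1 * x\<^sub>3\<^sub>3 = x\<^sub>1\<^sub>3 * x\<^sub>3\<^sub>1"
proof -
  have "(x\<^sub>1\<^sub>1 * x\<^sub>3\<^sub>3) * (x\<^sub>2\<^sub>2 * x\<^sub>2\<^sub>2) = (x\<^sub>1\<^sub>1 * x\<^sub>2\<^sub>2) * (x\<^sub>2\<^sub>2 * x\<^sub>3\<^sub>3)" by (simp add: mult_ac)
  also have "\<dots> = (x\<^sub>1\<^sub>2 * x\<^sub>2\<^sub>3) * (x\<^sub>2\<^sub>1 * x\<^sub>3\<^sub>2)" unfolding assms(1,4) by (simp add: mult_ac)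
  also have "\<dots> = (x\<^sub>1\<^sub>3 * x\<^sub>3\<^sub>1) * (x\<^sub>2\<^sub>2 * x\<^sub>2\<^sub>2)" unfolding assms(2,3) by (simp add: mult_ac)
  finally show ?thesis using assms(5) by simp
qed

section \<open>Samuelson first integrals in the coordinates of the parametrization\<close>

text \<open>A path-connected part of a level set of \<open>w\<close> lies in one leaf and, being
  inside \<open>V\<close>, in one path component of that leaf within \<open>V\<close>, where any
  first integral is constant. This ties an arbitrary first integral to the given function
  \<open>w\<close>.\<close>

lemma first_integral_on_constant:
  assumes u: "first_integral_on V (level_foliation M w) u"
    and S: "path_connected S" "S \<subseteq> V" "S \<subseteq> M" "\<And>s. s \<in> S \<Longrightarrow> w s = c"
    and qr: "q \<in> S" "r \<in> S"
  shows "u q = u r"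
proof -
  define l where "l = path_component_set {r\<in>M. w r = w q} q"
  have l: "l \<in> level_foliation M w" using qr S(3) unfolding l_def level_foliation_def by blast
  have "S \<subseteq> {r\<in>M. w r = w q}" using S(3,4) qr by auto
  then have "S \<subseteq> l" unfolding l_def using path_component_maximal[OF qr(1) S(1)] by blast
  then have "S \<subseteq> path_component_set (l \<inter> V) q"
    using path_component_maximal[OF qr(1) S(1), of "l \<inter> V"] S(2) by blast
  then have "path_component (l \<inter> V) q r" using qr(2) by blast
  then show ?thesis using u l unfolding first_integral_on_def by blast
qed

lemma is_interval_Icc_subset:
  fixes A :: "real set"
  assumes "is_interval A" "a \<in> A" "a' \<in> A"
  shows "{a..a'} \<subseteq> A"
  using mem_is_interval_1_I[OF assms] by auto

text \<open>A continuous injective function on an interval is strictly monotone, so the intermediate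
  value theorem applies. \<open>min\<close> and \<open>max\<close> admit both orientations, since
  the first integrals in the Samuelson condition may decrease in the coordinates.\<close>

lemma between_image_iff:
  fixes \<alpha> :: "real \<Rightarrow> real"
  assumes A: "is_interval A" "continuous_on A \<alpha>" "inj_on \<alpha> A" and a: "a \<in> A" "a' \<in> A" "a < a'"
  shows "min (\<alpha> a) (\<alpha> a') < x \<and> x < max (\<alpha> a) (\<alpha> a') \<longleftrightarrow> (\<exists>s\<in>{a<..<a'}. \<alpha> s = x)"
proof -
  have sub: "{a..a'} \<subseteq> A" using is_interval_Icc_subset A(1) a by blast
  have "{a<..<a'} \<subseteq> A" using sub by auto
  then have mono: "(\<forall>s\<in>{a<..<a'}. \<alpha> a < \<alpha> s \<and> \<alpha> s < \<alpha> a') \<or> (\<forall>s\<in>{a<..<a'}. \<alpha> a' < \<alpha> s \<and> \<alpha> s < \<alpha> a)"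
    using injective_eq_monotone_map[OF A(1,2)] A(3) a
    unfolding monotone_on_def by (metis greaterThanLessThan_iff subsetD)
  have cont: "continuous_on {a..a'} \<alpha>" using A(2) sub by (rule continuous_on_subset)
  have ivt: "\<exists>s\<in>{a<..<a'}. \<alpha> s = x" if "min (\<alpha> a) (\<alpha> a') < x" "x < max (\<alpha> a) (\<alpha> a')"
  proof -
    have "\<exists>s. a \<le> s \<and> s \<le> a' \<and> \<alpha> s = x"
      using IVT'[of \<alpha> a x a'] IVT2'[of \<alpha> a' x a] that cont a(3)
      by (cases "\<alpha> a \<le> \<alpha> a'") (simp_all add: min_def max_def)
    then obtain s where s: "a \<le> s" "s \<le> a'" "\<alpha> s = x" by blast
    moreover have "s \<noteq> a" "s \<noteq> a'" using that s by auto
    ultimately show ?thesis by force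
  qed
  show ?thesis
  proof
    assume "\<exists>s\<in>{a<..<a'}. \<alpha> s = x"
    then show "min (\<alpha> a) (\<alpha> a') < x \<and> x < max (\<alpha> a) (\<alpha> a')" using mono by fastforce
  qed (use ivt in blast)
qed

text \<open>The condition provides some first integrals \<open>u\<close>, \<open>v\<close> near the
  point, not the coordinates themselves. On a small rectangle each is a strictly monotone function
  of one coordinate, so their quadrilaterals are the images of boxes, and positive areas allow the
  quotients to be cross-multiplied.\<close>

lemma samuelson_condition_box_identity:
  fixes f :: "real \<times> real \<Rightarrow> real \<times> real"
  defines "m \<equiv> \<lambda>a a' b b'. measure lborel (f ` ({a<..<a'} \<times> {b<..<b'}))"
  assumes P: "open P" "inj_on f P" "continuous_on P f" "p \<in> P"
    and sam: "samuelson_condition (f ` P) (level_foliation (f ` P) (fst \<circ> inv_into P f),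
        level_foliation (f ` P) (snd \<circ> inv_into P f))"
    and pos: "\<And>a a' b b'. a < a' \<Longrightarrow> b < b' \<Longrightarrow> {a..a'} \<times> {b..b'} \<subseteq> P \<Longrightarrow> m a a' b b' > 0"
  obtains A B where "open A" "open B" "is_interval A" "is_interval B" "p \<in> A \<times> B" "A \<times> B \<subseteq> P"
    "\<And>a0 a1 a2 b0 b1 b2. {a0, a1, a2} \<subseteq> A \<Longrightarrow> {b0, b1, b2} \<subseteq> B \<Longrightarrow>
       a0 < a1 \<Longrightarrow> a1 < a2 \<Longrightarrow> b0 < b1 \<Longrightarrow> b1 < b2 \<Longrightarrow>
       m a0 a1 b0 b1 * m a1 a2 b1 b2 = m a0 a1 b1 b2 * m a1 a2 b0 b1"
proof -
  have "f p \<in> f ` P" using P(4) by blast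
  then obtain V K L u v where V: "open V" "f p \<in> V" "V \<subseteq> f ` P"
    and fi: "first_integral_on V (level_foliation (f ` P) (fst \<circ> inv_into P f)) u"
      "first_integral_on V (level_foliation (f ` P) (snd \<circ> inv_into P f)) v"
    and diff: "diffeomorphism_on V (K \<times> L) (\<lambda>q. (u q, v q))"
    and ratio: "\<forall>u\<^sub>0\<in>K. \<forall>u\<^sub>1\<in>K. \<forall>u\<^sub>2\<in>K. \<forall>v\<^sub>0\<in>L. \<forall>v\<^sub>1\<in>L. \<forall>v\<^sub>2\<in>L.
           u\<^sub>0 < u\<^sub>1 \<and> u\<^sub>1 < u\<^sub>2 \<and> v\<^sub>0 < v\<^sub>1 \<and> v\<^sub>1 < v\<^sub>2 \<longrightarrow>
           quad_area V u v u\<^sub>0 u\<^sub>1 v\<^sub>0 v\<^sub>1 / quad_area V u v u\<^sub>0 u\<^sub>1 v\<^sub>1 v\<^sub>2 =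
           quad_area V u v u\<^sub>1 u\<^sub>2 v\<^sub>0 v\<^sub>1 / quad_area V u v u\<^sub>1 u\<^sub>2 v\<^sub>1 v\<^sub>2"
    using sam unfolding samuelson_condition_def fst_conv snd_conv by meson
  have "open (P \<inter> f -` V)" using continuous_open_preimage[OF P(3,1) V(1)] .
  moreover have "p \<in> P \<inter> f -` V" using P V by blast
  ultimately obtain A' B' where AB': "open A'" "open B'" "p \<in> A' \<times> B'" "A' \<times> B' \<subseteq> P \<inter> f -` V"
    by (rule open_prod_elim)
  then have "fst p \<in> A'" "snd p \<in> B'" by (auto simp: mem_Times_iff)
  then obtain ra rb where r: "ra > 0" "ball (fst p) ra \<subseteq> A'" "rb > 0" "ball (snd p) rb \<subseteq> B'"
    using AB'(1,2) unfolding open_contains_ball by blast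
  define A B where "A = ball (fst p) ra" and "B = ball (snd p) rb"
  have "A \<times> B \<subseteq> P \<inter> f -` V" using r AB'(4) unfolding A_def B_def by blast
  then have AB: "open A" "open B" "is_interval A" "is_interval B" "fst p \<in> A" "snd p \<in> B"
      "A \<times> B \<subseteq> P" "f ` (A \<times> B) \<subseteq> V"
    using r(1,3) by (simp_all add: A_def B_def is_interval_ball_real image_subset_iff_subset_vimage)
  have contf: "continuous_on (A \<times> B) f" using P(3) AB(7) by (rule continuous_on_subset)
  have uconst: "u (f (a, b)) = u (f (a, b'))" if ab: "a \<in> A" "b \<in> B" "b' \<in> B" for a b b'
  proof (rule first_integral_on_constant[OF fi(1)])
    show "path_connected (f ` ({a} \<times> B))"
      using AB(4) ab by (intro path_connected_continuous_image continuous_on_subset[OF contf]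
          convex_imp_path_connected convex_Times) (auto simp: is_interval_convex_1)
    show "f ` ({a} \<times> B) \<subseteq> V" "f ` ({a} \<times> B) \<subseteq> f ` P" using AB(7,8) ab by blast+
    show "(fst \<circ> inv_into P f) s = a" if "s \<in> f ` ({a} \<times> B)" for s
      using that AB(7) ab P(2) by (auto simp: subset_iff inv_into_f_f)
  qed (use ab in auto)
  have vconst: "v (f (a, b)) = v (f (a', b))" if ab: "a \<in> A" "a' \<in> A" "b \<in> B" for a a' b
  proof (rule first_integral_on_constant[OF fi(2)])
    show "path_connected (f ` (A \<times> {b}))"
      using AB(3) ab by (intro path_connected_continuous_image continuous_on_subset[OF contf]
          convex_imp_path_connected convex_Times) (auto simp: is_interval_convex_1)
    show "f ` (A \<times> {b}) \<subseteq> V" "f ` (A \<times> {b}) \<subseteq> f ` P" using AB(7,8) ab by blast+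
    show "(snd \<circ> inv_into P f) s = b" if "s \<in> f ` (A \<times> {b})" for s
      using that AB(7) ab P(2) by (auto simp: subset_iff inv_into_f_f)
  qed (use ab in auto)
  \<comment> \<open>Inside the rectangle \<open>u\<close> and \<open>v\<close> are each constant
    along one family of coordinate lines, so their values on the two lines through \<open>p\<close>
    determine them.\<close>
  define \<alpha> where "\<alpha> a = u (f (a, snd p))" for a
  define \<beta> where "\<beta> b = v (f (fst p, b))" for b
  have uv: "u (f (a, b)) = \<alpha> a" "v (f (a, b)) = \<beta> b" if "a \<in> A" "b \<in> B" for a b
    unfolding \<alpha>_def \<beta>_def using uconst vconst that AB(5,6) by blast+
  have injV: "inj_on (\<lambda>q. (u q, v q)) V" and imV: "(\<lambda>q. (u q, v q)) ` V = K \<times> L"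
    using diff unfolding diffeomorphism_on_def bij_betw_def by auto
  have eqI: "(a, b) = (a', b')" if ab: "a \<in> A" "b \<in> B" "a' \<in> A" "b' \<in> B" "\<alpha> a = \<alpha> a'" "\<beta> b = \<beta> b'"
    for a b a' b'
  proof -
    have "f (a, b) = f (a', b')"
      by (rule inj_onD[OF injV]) (use ab AB(8) uv in auto)
    then show ?thesis by (rule inj_onD[OF P(2)]) (use ab AB(7) in auto)
  qed
  have inj: "inj_on \<alpha> A" "inj_on \<beta> B"
    using eqI AB(5,6) by (auto intro!: inj_onI)
  have KL: "\<alpha> a \<in> K" "\<beta> b \<in> L" if "a \<in> A" "b \<in> B" for a b
  proof -
    have "f (a, b) \<in> V" using AB(8) that by blast
    then have "(\<alpha> a, \<beta> b) \<in> K \<times> L" using imV uv[OF that] by force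
    then show "\<alpha> a \<in> K" "\<beta> b \<in> L" by auto
  qed
  have cu: "continuous_on V u" "continuous_on V v"
    using fi smooth_on_continuous unfolding first_integral_on_def by blast+
  have "continuous_on A (\<lambda>a. f (a, snd p))" "continuous_on B (\<lambda>b. f (fst p, b))"
    using AB(5,6) by (auto intro!: continuous_on_compose2[OF contf] continuous_intros)
  then have cont: "continuous_on A \<alpha>" "continuous_on B \<beta>"
    unfolding \<alpha>_def \<beta>_def using AB(5,6,8)
    by (auto intro!: continuous_on_compose2[OF cu(1)] continuous_on_compose2[OF cu(2)])
  have quad: "quad_area V u v (min (\<alpha> a) (\<alpha> a')) (max (\<alpha> a) (\<alpha> a')) (min (\<beta> b) (\<beta> b')) (max (\<beta> b) (\<beta> b'))
      = m a a' b b'"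
    if ab: "a \<in> A" "a' \<in> A" "a < a'" "b \<in> B" "b' \<in> B" "b < b'" for a a' b b'
  proof -
    have sub: "{a<..<a'} \<subseteq> A" "{b<..<b'} \<subseteq> B"
      using is_interval_Icc_subset[OF AB(3) ab(1,2)] is_interval_Icc_subset[OF AB(4) ab(4,5)] by auto
    have iff: "(min (\<alpha> a) (\<alpha> a') < u q \<and> u q < max (\<alpha> a) (\<alpha> a')) \<and>
        (min (\<beta> b) (\<beta> b') < v q \<and> v q < max (\<beta> b) (\<beta> b')) \<longleftrightarrow>
        (\<exists>s\<in>{a<..<a'}. \<exists>t\<in>{b<..<b'}. \<alpha> s = u q \<and> \<beta> t = v q)" for q
      unfolding between_image_iff[OF AB(3) cont(1) inj(1) ab(1-3)]
        between_image_iff[OF AB(4) cont(2) inj(2) ab(4-6)] by auto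
    \<comment> \<open>\<open>V\<close> may reach beyond the image of the rectangle; injectivity of
      \<open>(u, v)\<close> on \<open>V\<close> excludes further points with the same
      values.\<close>
    have "{q\<in>V. \<exists>s\<in>{a<..<a'}. \<exists>t\<in>{b<..<b'}. \<alpha> s = u q \<and> \<beta> t = v q} =
        f ` ({a<..<a'} \<times> {b<..<b'})" (is "?S = ?T")
    proof
      show "?S \<subseteq> ?T"
      proof
        fix q assume "q \<in> ?S"
        then obtain s t where q: "q \<in> V" "s \<in> {a<..<a'}" "t \<in> {b<..<b'}" "\<alpha> s = u q" "\<beta> t = v q"
          by (auto simp only: mem_Collect_eq)
        then have st: "s \<in> A" "t \<in> B" using sub by auto
        then have "f (s, t) \<in> V" using AB(8) by blast
        moreover have "(u (f (s, t)), v (f (s, t))) = (u q, v q)" using uv[OF st] q(4,5) by simp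
        ultimately have "f (s, t) = q" using inj_onD[OF injV] q(1) by blast
        then show "q \<in> ?T" using q(2,3) by blast
      qed
      show "?T \<subseteq> ?S"
      proof
        fix q assume "q \<in> ?T"
        then obtain s t where q: "q = f (s, t)" "s \<in> {a<..<a'}" "t \<in> {b<..<b'}" by blast
        then have st: "s \<in> A" "t \<in> B" using sub by auto
        then have "q \<in> V" using AB(8) q(1) by blast
        then show "q \<in> ?S" using q uv[OF st] by auto
      qed
    qed
    then show ?thesis unfolding quad_area_def m_def iff[symmetric] by (simp add: conj_assoc)
  qed
  have mpos: "m a a' b b' > 0" if ab: "a \<in> A" "a' \<in> A" "a < a'" "b \<in> B" "b' \<in> B" "b < b'" for a a' b b'
  proof (rule pos[OF ab(3,6)])
    show "{a..a'} \<times> {b..b'} \<subseteq> P"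
      using Sigma_mono[OF is_interval_Icc_subset[OF AB(3) ab(1,2)] is_interval_Icc_subset[OF AB(4) ab(4,5)]]
        AB(7) by (rule subset_trans)
  qed
  let ?q = "quad_area V u v"
  have cross: "?q u\<^sub>0 u\<^sub>1 v\<^sub>0 v\<^sub>1 * ?q u\<^sub>1 u\<^sub>2 v\<^sub>1 v\<^sub>2 = ?q u\<^sub>0 u\<^sub>1 v\<^sub>1 v\<^sub>2 * ?q u\<^sub>1 u\<^sub>2 v\<^sub>0 v\<^sub>1"
    if "u\<^sub>0 \<in> K" "u\<^sub>1 \<in> K" "u\<^sub>2 \<in> K" "v\<^sub>0 \<in> L" "v\<^sub>1 \<in> L" "v\<^sub>2 \<in> L"
      "u\<^sub>0 < u\<^sub>1" "u\<^sub>1 < u\<^sub>2" "v\<^sub>0 < v\<^sub>1" "v\<^sub>1 < v\<^sub>2" "?q u\<^sub>0 u\<^sub>1 v\<^sub>1 v\<^sub>2 > 0" "?q u\<^sub>1 u\<^sub>2 v\<^sub>1 v\<^sub>2 > 0"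
    for u\<^sub>0 u\<^sub>1 u\<^sub>2 v\<^sub>0 v\<^sub>1 v\<^sub>2
  proof -
    have "?q u\<^sub>0 u\<^sub>1 v\<^sub>0 v\<^sub>1 / ?q u\<^sub>0 u\<^sub>1 v\<^sub>1 v\<^sub>2 = ?q u\<^sub>1 u\<^sub>2 v\<^sub>0 v\<^sub>1 / ?q u\<^sub>1 u\<^sub>2 v\<^sub>1 v\<^sub>2"
      using ratio that(1-10) by blast
    then show ?thesis using that(11,12) by (simp add: frac_eq_eq mult.commute)
  qed
  show ?thesis
  proof (rule that[OF AB(1-4) _ AB(7)])
    show "p \<in> A \<times> B" using AB(5,6) by (simp add: mem_Times_iff)
    fix a0 a1 a2 b0 b1 b2
    assume a: "{a0, a1, a2} \<subseteq> A" "a0 < a1" "a1 < a2" and b: "{b0, b1, b2} \<subseteq> B" "b0 < b1" "b1 < b2"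
    note in_KL = KL[of a0 b0] KL[of a1 b1] KL[of a2 b2]
    have m: "m a0 a1 b0 b1 > 0" "m a0 a1 b1 b2 > 0" "m a1 a2 b0 b1 > 0" "m a1 a2 b1 b2 > 0"
      using a b by (auto intro!: mpos)
    note q = quad[of a0 a1 b0 b1] quad[of a0 a1 b1 b2] quad[of a1 a2 b0 b1] quad[of a1 a2 b1 b2]
    have "\<alpha> a0 < \<alpha> a1 \<and> \<alpha> a1 < \<alpha> a2 \<or> \<alpha> a2 < \<alpha> a1 \<and> \<alpha> a1 < \<alpha> a0"
      using injective_eq_monotone_map[OF AB(3) cont(1)] inj(1) a unfolding monotone_on_def by auto
    moreover have "\<beta> b0 < \<beta> b1 \<and> \<beta> b1 < \<beta> b2 \<or> \<beta> b2 < \<beta> b1 \<and> \<beta> b1 < \<beta> b0"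
      using injective_eq_monotone_map[OF AB(4) cont(2)] inj(2) b unfolding monotone_on_def by auto
    \<comment> \<open>Either first integral may reverse orientation. The product identity is
      invariant under exchanging the two rows or the two columns, so all four cases give the same
      equation.\<close>
    ultimately consider
        "\<alpha> a0 < \<alpha> a1" "\<alpha> a1 < \<alpha> a2" "\<beta> b0 < \<beta> b1" "\<beta> b1 < \<beta> b2"
      | "\<alpha> a0 < \<alpha> a1" "\<alpha> a1 < \<alpha> a2" "\<beta> b2 < \<beta> b1" "\<beta> b1 < \<beta> b0"
      | "\<alpha> a2 < \<alpha> a1" "\<alpha> a1 < \<alpha> a0" "\<beta> b0 < \<beta> b1" "\<beta> b1 < \<beta> b2"
      | "\<alpha> a2 < \<alpha> a1" "\<alpha> a1 < \<alpha> a0" "\<beta> b2 < \<beta> b1" "\<beta> b1 < \<beta> b0"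
      by blast
    then show "m a0 a1 b0 b1 * m a1 a2 b1 b2 = m a0 a1 b1 b2 * m a1 a2 b0 b1"
    proof cases
      case 1
      then show ?thesis
        using cross[of "\<alpha> a0" "\<alpha> a1" "\<alpha> a2" "\<beta> b0" "\<beta> b1" "\<beta> b2"] in_KL a b q m by simp
    next
      case 2
      then show ?thesis
        using cross[of "\<alpha> a0" "\<alpha> a1" "\<alpha> a2" "\<beta> b2" "\<beta> b1" "\<beta> b0"] in_KL a b q m by simp
    next
      case 3
      then show ?thesis
        using cross[of "\<alpha> a2" "\<alpha> a1" "\<alpha> a0" "\<beta> b0" "\<beta> b1" "\<beta> b2"] in_KL a b q m by (simp add: mult.commute)
    next
      case 4
      then show ?thesis
        using cross[of "\<alpha> a2" "\<alpha> a1" "\<alpha> a0" "\<beta> b2" "\<beta> b1" "\<beta> b0"] in_KL a b q m by (simp add: mult.commute)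
    qed
  qed
qed

section \<open>From adjacent boxes to a pointwise identity for the Jacobian, and the
  contradiction\<close>

theorem theorem5p1:
  fixes U I J :: "real set" and h :: "real \<Rightarrow> real"
  assumes "open U" "is_interval U"
    and "real_analytic_on U h"
    and "\<not> (\<forall>t\<in>U. deriv (deriv h) t = 0)"
    and "open I" "is_interval I" "I \<noteq> {}" "I \<subseteq> U"
    and "open J" "is_interval J" "J \<noteq> {}" "J \<subseteq> U"
    and "I \<inter> J = {}"
    and "local_diffeomorphism_on (I \<times> J) (line_meet h)"
  shows "\<not> (\<forall>P. open P \<and> P \<subseteq> I \<times> J \<and> inj_on (line_meet h) P \<longrightarrow>
              samuelson_condition (line_meet h ` P) (tangent_web h P))"
proof
  assume sam: "\<forall>P. open P \<and> P \<subseteq> I \<times> J \<and> inj_on (line_meet h) P \<longrightarrow>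
              samuelson_condition (line_meet h ` P) (tangent_web h P)"
  let ?f = "line_meet h" and ?J = "meet_jacobian h"
  have h: "holo_extends U h" using assms(1,3) by (rule holo_extends_real_analytic)
  have d: "(?f has_derivative meet_deriv h p) (at p)" and J: "?J p \<noteq> 0"
    "?J p = fst (meet_deriv h p (1, 0)) * snd (meet_deriv h p (0, 1)) -
       fst (meet_deriv h p (0, 1)) * snd (meet_deriv h p (1, 0))" if "p \<in> I \<times> J" for p
  proof -
    obtain u v where p: "p = (u, v)" "u \<in> I" "v \<in> J" using \<open>p \<in> I \<times> J\<close> by blast
    then have uv: "u \<noteq> v" using assms(13) by blast
    have hd: "(h has_real_derivative deriv h u) (at u)" "(h has_real_derivative deriv h v) (at v)"
      using holo_extends_deriv(1)[OF h] p assms(8,12) by blast+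
    show "(?f has_derivative meet_deriv h p) (at p)"
      unfolding p(1) using line_meet_has_derivative[OF hd uv] .
    show "?J p \<noteq> 0"
      unfolding p(1) by (rule meet_jacobian_nonzero[OF assms(14) _ uv hd]) (use p in simp)
    show "?J p = fst (meet_deriv h p (1, 0)) * snd (meet_deriv h p (0, 1)) -
       fst (meet_deriv h p (0, 1)) * snd (meet_deriv h p (1, 0))"
      unfolding p(1) by (rule meet_jacobian_eq[OF uv])
  qed
  \<comment> \<open>One chart domain \<open>P\<close> around a single point is enough: it is among
    the sets for which the condition is assumed.\<close>
  obtain p where "p \<in> I \<times> J" using assms(7,11) by blast
  then obtain P where P: "p \<in> P" "P \<subseteq> I \<times> J" "diffeomorphism_on P (?f ` P) ?f"
    using assms(14) unfolding local_diffeomorphism_on_def by blast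
  have P': "open P" "inj_on ?f P" "continuous_on P ?f"
    using P(3) smooth_on_continuous unfolding diffeomorphism_on_def bij_betw_def by blast+
  have samP: "samuelson_condition (?f ` P) (level_foliation (?f ` P) (fst \<circ> inv_into P ?f),
        level_foliation (?f ` P) (snd \<circ> inv_into P ?f))"
    using sam P(2) P'(1,2) unfolding tangent_web_def by blast
  have contJ: "continuous_on P ?J"
    using continuous_on_meet_jacobian[OF h assms(8,12,13)] P(2) by (rule continuous_on_subset)
  have PIJ: "q \<in> I \<times> J" if "q \<in> P" for q using P(2) that by (rule subsetD)
  let ?m = "\<lambda>a a' b b'. measure lborel (?f ` ({a<..<a'} \<times> {b<..<b'}))"
  have pos: "?m a a' b b' > 0" if "a < a'" "b < b'" "{a..a'} \<times> {b..b'} \<subseteq> P" for a a' b b'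
    by (rule measure_image_box_pos[OF P'(1,2) d[OF PIJ] J(2)[OF PIJ] contJ that J(1)[OF PIJ]])
  have lim: "((\<lambda>e. ?m a (a + e) b (b + e) / e\<^sup>2) \<longlongrightarrow> \<bar>?J (a, b)\<bar>) (at_right 0)"
    if "(a, b) \<in> P" for a b
    by (rule measure_image_square_tendsto[OF P'(1,2) d[OF PIJ] J(2)[OF PIJ] contJ that])
  show False
  proof (rule samuelson_condition_box_identity[OF P'(1,2,3) P(1) samP pos])
    fix A B
    assume AB: "open A" "open B" "is_interval A" "is_interval B" "p \<in> A \<times> B" "A \<times> B \<subseteq> P"
      and adj: "\<And>a0 a1 a2 b0 b1 b2. {a0, a1, a2} \<subseteq> A \<Longrightarrow> {b0, b1, b2} \<subseteq> B \<Longrightarrow>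
         a0 < a1 \<Longrightarrow> a1 < a2 \<Longrightarrow> b0 < b1 \<Longrightarrow> b1 < b2 \<Longrightarrow>
         ?m a0 a1 b0 b1 * ?m a1 a2 b1 b2 = ?m a0 a1 b1 b2 * ?m a1 a2 b0 b1"
    have sub: "A \<subseteq> I" "B \<subseteq> J"
      using AB(5,6) P(2) by blast+
    \<comment> \<open>The small intervals \<open>A\<close> and \<open>B\<close> take the place of
      \<open>I\<close> and \<open>J\<close>; the continuation still runs through all of
      \<open>U\<close>.\<close>
    show False
    proof (rule not_product_jacobian[OF h assms(2) AB(1) _ _ AB(2)])
      show "A \<noteq> {}" "B \<noteq> {}" using AB(5) by auto
      show "A \<subseteq> U" "B \<subseteq> U" "A \<inter> B = {}" using sub assms(8,12,13) by blast+
      show "?J (u, v) \<noteq> 0" if "u \<in> A" "v \<in> B" for u v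
        using J(1) sub that by blast
      show "\<bar>?J (u, v) * ?J (u', v')\<bar> = \<bar>?J (u, v') * ?J (u', v)\<bar>"
        if uv: "u \<in> A" "u' \<in> A" "u < u'" "v \<in> B" "v' \<in> B" "v < v'" for u u' v v'
      proof -
        \<comment> \<open>The area of the image of a square of side \<open>e\<close>, relative to
          the area of the square; it tends to the absolute Jacobian at the corner.\<close>
        define Q where "Q a b e = ?m a (a + e) b (b + e) / e\<^sup>2" for a b e
        have Q: "(Q a b \<longlongrightarrow> \<bar>?J (a, b)\<bar>) (at_right 0)" if "a \<in> A" "b \<in> B" for a b
          unfolding Q_def by (rule lim) (use AB(6) that in auto)
        obtain ra where ra: "ra > 0" "ball u' ra \<subseteq> A" by (rule openE[OF AB(1) uv(2)])
        obtain rb where rb: "rb > 0" "ball v' rb \<subseteq> B" by (rule openE[OF AB(2) uv(5)])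
        \<comment> \<open>The bounds \<open>ra\<close>, \<open>rb\<close> keep the squares inside
          \<open>A \<times> B\<close>; the bounds \<open>u' - u\<close>, \<open>v' - v\<close> keep
          a nondegenerate cell between them.\<close>
        have "eventually (\<lambda>e. e \<in> {0<..<min (min ra rb) (min (u' - u) (v' - v))}) (at_right 0)"
          using ra rb uv by (intro eventually_at_right_real) auto
        then have "eventually (\<lambda>e. Q u v e * Q u' v' e = Q u v' e * Q u' v e) (at_right 0)"
        proof eventually_elim
          case (elim e)
          have "u' + e \<in> ball u' ra" "v' + e \<in> ball v' rb" using elim by (auto simp: dist_real_def)
          then have e': "u' + e \<in> A" "v' + e \<in> B" using ra rb by blast+
          have "u + e \<in> {u..u'}" "v + e \<in> {v..v'}" using elim by auto
          then have e: "u + e \<in> A" "v + e \<in> B"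
            using subsetD[OF is_interval_Icc_subset[OF AB(3) uv(1,2)]]
              subsetD[OF is_interval_Icc_subset[OF AB(4) uv(4,5)]] by simp_all
          have lt: "u < u + e" "u + e < u'" "u' < u' + e" "v < v + e" "v + e < v'" "v' < v' + e"
            using elim by auto
          have "{u + e..u'} \<times> {v + e..v'} \<subseteq> P"
            using Sigma_mono[OF is_interval_Icc_subset[OF AB(3) e(1) uv(2)]
              is_interval_Icc_subset[OF AB(4) e(2) uv(5)]] AB(6) by (rule subset_trans)
          then have "0 < ?m (u + e) u' (v + e) v'" by (rule pos[OF lt(2,5)])
          then have nz: "?m (u + e) u' (v + e) v' \<noteq> 0" by simp
          have "{u, u + e, u'} \<subseteq> A" "{u + e, u', u' + e} \<subseteq> A"
            "{v, v + e, v'} \<subseteq> B" "{v + e, v', v' + e} \<subseteq> B"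
            using uv e e' by simp_all
          \<comment> \<open>The values \<open>u\<close>, \<open>u + e\<close>, \<open>u'\<close>,
            \<open>u' + e\<close> and their counterparts for \<open>v\<close> cut out a three by
            three grid whose corner cells are the four squares. The adjacent identity is taken for
            each of its four two by two blocks.\<close>
          note grid = adj[OF this(1,3) lt(1,2,4,5)] adj[OF this(1,4) lt(1,2,5,6)]
            adj[OF this(2,3) lt(2,3,4,5)] adj[OF this(2,4) lt(2,3,5,6)]
          have "?m u (u + e) v (v + e) * ?m u' (u' + e) v' (v' + e) =
              ?m u (u + e) v' (v' + e) * ?m u' (u' + e) v (v + e)"
            by (rule cross_ratio_grid[OF grid nz])
          then show ?case unfolding Q_def by simp
        qed
        moreover have "((\<lambda>e. Q u v e * Q u' v' e) \<longlongrightarrow> \<bar>?J (u, v)\<bar> * \<bar>?J (u', v')\<bar>) (at_right 0)"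
          using uv by (intro tendsto_mult Q)
        ultimately have "((\<lambda>e. Q u v' e * Q u' v e) \<longlongrightarrow> \<bar>?J (u, v)\<bar> * \<bar>?J (u', v')\<bar>) (at_right 0)"
          by (rule Lim_transform_eventually[rotated])
        moreover have "((\<lambda>e. Q u v' e * Q u' v e) \<longlongrightarrow> \<bar>?J (u, v')\<bar> * \<bar>?J (u', v)\<bar>) (at_right 0)"
          using uv by (intro tendsto_mult Q)
        ultimately show ?thesis
          unfolding abs_mult by (intro tendsto_unique[OF trivial_limit_at_right_real])
      qed
    qed
  qed
qed

end
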